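(* Let $P\ge2$ and let $X^{p,q}$ be a Damek–Ricci space of dimension $n=p+q+1\ge1+P(P-1)$. Let $o\in X^{p,q}$, $r=d(o,\cdot)$, $h:=(p+2q)/2$, $\Lambda_P(X^{p,q}):=(h/P)^P$, and $$g(r):=\coth(r/2)-\frac{2}{p+2q}\Big(\frac{q}{\sinh(r)}+\frac1r\Big).$$ Then $g(r)\ge\frac{p+q-1}{h\,r}$ for all $r>0$, $g(r)\to1$ as $r\to\infty$, and for all $\phi\in C_c^\infty(X^{p,q})$, $$\int_{X^{p,q}}|\nabla\phi|^Pdx-\Lambda_P(X^{p,q})\int_{X^{p,q}}g(r)^{P-2}|\phi|^Pdx\ge\frac{h^{P-2}(P-1)^2}{P^P}\int_{X^{p,q}}\frac{g(r)^{P-2}}{r^2}|\phi|^Pdx+\frac{h^{P-1}(P-2)}{P^P}\int_{X^{p,q}}\frac{g(r)^{P-2}\big(g(r)+\frac1{hr}\big)}{r}|\phi|^Pdx$$ $$+\frac{h^{P-2}}{P^P}\int_{X^{p,q}}g(r)^{P-2}\Big(\frac{q^2-qP(P-1)}{\sinh^2(r)}+\frac{p(2h-P(P-1))}{4\sinh^2(r/2)}\Big)|\phi|^Pdx.$$ Moreover, all integrands on the right-hand side of this inequality are non-negative functions.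
   Context: Damek–Ricci space $X^{p,q}$: let $\mathfrak n=\mathfrak v\oplus\mathfrak z$ be a real 2-step nilpotent Lie algebra with centre $\mathfrak z$ and an inner product making the decomposition orthogonal, $\dim\mathfrak v=p$, $\dim\mathfrak z=q\ge1$, with $J_Z:\mathfrak v\to\mathfrak v$ defined by $\langle J_ZV,V'\rangle=\langle Z,[V,V']\rangle$ satisfying $J_Z^2=-\|Z\|^2\mathrm{Id}$. Let $\mathfrak s=\mathfrak n\oplus\mathbb RH$ with $[H,V]=\frac12V$, $[H,Z]=Z$, $\|H\|=1$, $H\perp\mathfrak n$; $X^{p,q}$ is the connected simply connected Lie group with Lie algebra $\mathfrak s$ and left-invariant metric given by this inner product at the identity. It is a complete simply connected harmonic manifold of dimension $p+q+1$; its volume element in geodesic polar coordinates about any point is $f(r)\,dr\,d\theta$ with $f(r)=2^p\sinh^p(r/2)\sinh^q(r)$, and $h=(p+2q)/2$ is its Cheeger constant. *)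

theory Defs
  imports "HOL-Analysis.Analysis"
begin

(* Coordinates: a point of the Damek-Ricci space S = N \<rtimes> A is (V, Z, t), standing for
   exp(V+Z) exp(tH), where v = 'v and z = 'z are Euclidean spaces (inner product from the type). *)

(* H-type condition on the bracket [.,.] : v x v -> z of the 2-step nilpotent algebra n = v (+) z
   (the centre of n is then exactly z, since q >= 1 and p >= 1). *)
definition Htype :: "('v::euclidean_space \<Rightarrow> 'v \<Rightarrow> 'z::euclidean_space) \<Rightarrow> bool" where
  "Htype br \<longleftrightarrow> bilinear br \<and> (\<forall>x y. br x y = - br y x) \<and>
     (\<forall>Z. \<exists>J. linear J \<and> (\<forall>V V'. inner (J V) V' = inner Z (br V V')) \<and>
               (\<forall>V. J (J V) = - ((norm Z)\<^sup>2) *\<^sub>R V))"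

(* group law of S: (n, exp tH)(n', exp sH) = (n delta_t(n'), exp (t+s)H), with
   (V,Z)(V',Z') = (V+V', Z+Z'+1/2[V,V']) on N and delta_t(V,Z) = (e^{t/2}V, e^t Z) *)
definition DR_mult :: "('v::euclidean_space \<Rightarrow> 'v \<Rightarrow> 'z::euclidean_space) \<Rightarrow>
    ('v \<times> 'z \<times> real) \<Rightarrow> ('v \<times> 'z \<times> real) \<Rightarrow> ('v \<times> 'z \<times> real)" where
  "DR_mult br x y = (case x of (V, Z, t) \<Rightarrow> case y of (V', Z', s) \<Rightarrow>
     (V + exp (t/2) *\<^sub>R V', Z + exp t *\<^sub>R Z' + (1/2) *\<^sub>R br V (exp (t/2) *\<^sub>R V'), t + s))"

(* DR_mc br x = inverse of the differential at the identity of left translation by x,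
   i.e. maps T_x S to s = v (+) z (+) RH (left-invariant Maurer-Cartan form). The left-invariant
   metric is  g_x(u,w) = <DR_mc br x u, DR_mc br x w>. *)
definition DR_mc :: "('v::euclidean_space \<Rightarrow> 'v \<Rightarrow> 'z::euclidean_space) \<Rightarrow>
    ('v \<times> 'z \<times> real) \<Rightarrow> ('v \<times> 'z \<times> real) \<Rightarrow> ('v \<times> 'z \<times> real)" where
  "DR_mc br x u = (case x of (V, Z, t) \<Rightarrow> case u of (a, b, c) \<Rightarrow>
     (exp (-t/2) *\<^sub>R a, exp (-t) *\<^sub>R (b - (1/2) *\<^sub>R br V a), c))"

definition DR_len :: "('v::euclidean_space \<Rightarrow> 'v \<Rightarrow> 'z::euclidean_space) \<Rightarrow>
    (real \<Rightarrow> 'v \<times> 'z \<times> real) \<Rightarrow> real" where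
  "DR_len br \<gamma> = integral {0..1}
     (\<lambda>s. norm (DR_mc br (\<gamma> s) (vector_derivative \<gamma> (at s within {0..1}))))"

definition DR_dist :: "('v::euclidean_space \<Rightarrow> 'v \<Rightarrow> 'z::euclidean_space) \<Rightarrow>
    ('v \<times> 'z \<times> real) \<Rightarrow> ('v \<times> 'z \<times> real) \<Rightarrow> real" where
  "DR_dist br x y = Inf {DR_len br \<gamma> | \<gamma>. \<gamma> C1_differentiable_on {0..1} \<and> \<gamma> 0 = x \<and> \<gamma> 1 = y}"

(* Riemannian volume measure: density sqrt(det g) = |det DR_mc br x| = exp(-(p/2+q) t)
   with respect to Lebesgue measure in the coordinates (V,Z,t). *)
definition DR_vol :: "('v::euclidean_space \<times> 'z::euclidean_space \<times> real) measure" where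
  "DR_vol = density lborel
     (\<lambda>x. ennreal (exp (- (real DIM('v) / 2 + real DIM('z)) * snd (snd x))))"

definition DR_grad_norm :: "('v::euclidean_space \<Rightarrow> 'v \<Rightarrow> 'z::euclidean_space) \<Rightarrow>
    ('v \<times> 'z \<times> real \<Rightarrow> real) \<Rightarrow> ('v \<times> 'z \<times> real) \<Rightarrow> real" where
  "DR_grad_norm br \<phi> x = Sup {frechet_derivative \<phi> (at x) u | u. norm (DR_mc br x u) \<le> 1}"

fun iter_dd :: "'a::real_normed_vector list \<Rightarrow> ('a \<Rightarrow> real) \<Rightarrow> 'a \<Rightarrow> real" where
  "iter_dd [] f = f"
| "iter_dd (u # us) f = (\<lambda>x. frechet_derivative (iter_dd us f) (at x) u)"

definition smooth_fun :: "('a::real_normed_vector \<Rightarrow> real) \<Rightarrow> bool" where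
  "smooth_fun f \<longleftrightarrow> (\<forall>us x. iter_dd us f differentiable (at x))"

definition compact_support :: "('a::real_normed_vector \<Rightarrow> real) \<Rightarrow> bool" where
  "compact_support f \<longleftrightarrow> compact (closure {x. f x \<noteq> 0})"

definition DR_g :: "real \<Rightarrow> real \<Rightarrow> real \<Rightarrow> real" where
  "DR_g p q r = cosh (r/2) / sinh (r/2) - 2 / (p + 2*q) * (q / sinh r + 1 / r)"

end

theory Submission
  imports Defs
begin

text \<open>
  For a vector field \<open>T = F(r) \<nabla>r\<close> with \<open>F \<ge> 0\<close>, integrating \<open>div T \<bar>\<phi>\<bar>\<^sup>P\<close> by parts and Young's inequality give
  \<open>\<integral> \<bar>\<nabla>\<phi>\<bar>\<^sup>P \<ge> \<integral> (F' + F \<Delta>r - (P - 1) F powr (P / (P - 1))) \<bar>\<phi>\<bar>\<^sup>P\<close>. Since \<open>h g = \<Delta>r - 1 / r\<close>, the choice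
  \<open>F = (h g / P) powr (P - 1)\<close> turns the weight on the right into exactly the sum of the four weights of the theorem.

  The geometry enters through \<open>w = cosh\<^sup>2 (r / 2) = ((1 + a + \<bar>V\<bar>\<^sup>2 / 4)\<^sup>2 + \<bar>Z\<bar>\<^sup>2) / (4 a)\<close> with \<open>a = exp t\<close>, which is
  smooth everywhere and satisfies \<open>\<bar>\<nabla>w\<bar>\<^sup>2 = w\<^sup>2 - w\<close> and \<open>\<Delta>w = (1 + h) w - (q + 1) / 2\<close>. The first identity bounds
  the Riemannian distance from below by \<open>arcosh (2 w - 1)\<close>, and the images of the radii of the unit ball under the
  Cayley transform attain this bound; the second one gives \<open>\<Delta>r\<close>.
\<close>

section \<open>Integration by parts and elementary inequalities\<close>

text \<open>The distance r is not smooth at the base point, but the gradient of w has coordinates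
  polynomial in V, Z, exp t and exp (- t). So the divergence theorem can be carried out in the flat
  chart, component by component and without geodesic polar coordinates; only the scalar profile F /
  sqrt (w^2 - w) in front of that gradient is singular and has to be cut off. The weights may blow
  up at the base point, and a Bochner integral of a non-integrable function is 0 by convention.
  Therefore the estimate is first proved for the nonnegative integral of the whole weight;
  integrability of each part follows from it. This step and Fatou's lemma need nonnegative weights,
  and for the curvature weight that is where n >= 1 + P(P - 1) enters. Origin of F: with \<Delta>r
  replaced by its limit h at infinity, a constant F maximises F h - (P - 1) F^(P/(P - 1)) at F =
  (h/P)^(P - 1), with value (h/P)^P, the spectral constant. Replacing h by h g, that is by \<Delta>r
  - 1/r, adds the Hardy terms in 1/r.\<close>

lemma has_derivative_eq_0_outside:
  fixes f :: "'a::real_normed_vector \<Rightarrow> 'b::real_normed_vector"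
  assumes "(f has_derivative f') (at x)" "closed K" "\<And>y. y \<notin> K \<Longrightarrow> f y = 0" "x \<notin> K"
  shows "f' = (\<lambda>_. 0)"
proof -
  have "(f has_derivative (\<lambda>_. 0)) (at x)"
  proof (rule has_derivative_transform_within_open[where s = "- K"])
    show "((\<lambda>_. 0) has_derivative (\<lambda>_. 0)) (at x)" by simp
  qed (use assms in \<open>simp_all add: open_Compl\<close>)
  then show ?thesis using has_derivative_unique[OF assms(1)] by blast
qed

text \<open>Translation invariance of \<open>lborel\<close> makes the integral of every difference
  quotient of \<open>G\<close> vanish. The quotients converge pointwise to the derivative, and the
  mean value theorem together with the compact support provides a dominating function.\<close>

lemma integral_directional_derivative:
  fixes G :: "'a::euclidean_space \<Rightarrow> real"
  assumes der: "\<And>x. (G has_derivative G' x) (at x)"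
    and cont: "continuous_on UNIV (\<lambda>x. G' x u)"
    and K: "compact K" and zero: "\<And>x. x \<notin> K \<Longrightarrow> G x = 0"
  shows "integrable lborel (\<lambda>x. G' x u)" "integral\<^sup>L lborel (\<lambda>x. G' x u) = 0"
proof -
  have G'0: "G' x u = 0" if "x \<notin> K" for x
    using has_derivative_eq_0_outside[OF der compact_imp_closed[OF K] zero that] by simp
  have contG: "continuous_on UNIV G"
    using der has_derivative_continuous continuous_at_imp_continuous_on by blast
  have ind: "integrable lborel f"
    if "continuous_on UNIV f" "\<And>x. x \<notin> K \<Longrightarrow> f x = 0" for f :: "'a \<Rightarrow> real"
  proof -
    have "integrable lborel (\<lambda>x. indicator K x *\<^sub>R f x)"
      by (rule borel_integrable_compact[OF K continuous_on_subset[OF that(1)]]) simp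
    moreover have "(\<lambda>x. indicator K x *\<^sub>R f x) = f"
      using that(2) by (force simp: indicator_def)
    ultimately show ?thesis by simp
  qed
  show "integrable lborel (\<lambda>x. G' x u)" using ind[OF cont G'0] .
  have "bounded ((\<lambda>x. G' x u) ` K)"
    using compact_continuous_image[OF continuous_on_subset[OF cont] K] compact_imp_bounded by blast
  then obtain M0 where M0: "\<And>x. x \<in> K \<Longrightarrow> \<bar>G' x u\<bar> \<le> M0"
    by (auto simp: bounded_iff)
  define M where "M = max M0 0"
  have M: "\<bar>G' x u\<bar> \<le> M" for x
    using M0[of x] G'0[of x] by (cases "x \<in> K") (auto simp: M_def)
  obtain R where R: "\<And>x. x \<in> K \<Longrightarrow> norm x \<le> R"
    using compact_imp_bounded[OF K] by (auto simp: bounded_iff)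
  have line: "((\<lambda>s. G (x + s *\<^sub>R u)) has_real_derivative G' (x + s *\<^sub>R u) u) (at s)" for x s
  proof -
    have "((\<lambda>s. G (x + s *\<^sub>R u)) has_derivative (\<lambda>d. G' (x + s *\<^sub>R u) (d *\<^sub>R u))) (at s)"
      by (rule has_derivative_compose[OF _ der]) (auto intro!: derivative_eq_intros)
    moreover have "(\<lambda>d. G' (x + s *\<^sub>R u) (d *\<^sub>R u)) = (*) (G' (x + s *\<^sub>R u) u)"
      using linear_scale[OF has_derivative_linear[OF der[of "x + s *\<^sub>R u"]]] by auto
    ultimately show ?thesis
      by (simp add: has_field_derivative_def)
  qed
  \<comment> \<open>Step sizes at most 1 keep all quotients supported in one ball, of radius
    \<open>R + norm u\<close>.\<close>
  define D where "D = (\<lambda>(n::nat) x. (G (x + inverse (real (Suc n)) *\<^sub>R u) - G x) / inverse (real (Suc n)))"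
  have limD: "(\<lambda>n. D n x) \<longlonglongrightarrow> G' x u" for x
  proof -
    have "((\<lambda>d. (G (x + d *\<^sub>R u) - G x) / d) \<longlongrightarrow> G' x u) (at 0)"
      using line[of x 0] by (simp add: has_field_derivative_iff)
    moreover have "filterlim (\<lambda>n. inverse (real (Suc n))) (at 0) sequentially"
      using LIMSEQ_inverse_real_of_nat by (auto simp: filterlim_at intro!: eventuallyI)
    ultimately show ?thesis
      unfolding D_def by (rule filterlim_compose)
  qed
  have boundD: "\<bar>D n x\<bar> \<le> M" for n x
  proof -
    let ?s = "inverse (real (Suc n))"
    have s: "?s > 0" by simp
    obtain z where "G (x + ?s *\<^sub>R u) - G (x + 0 *\<^sub>R u) = (?s - 0) * G' (x + z *\<^sub>R u) u"
      using MVT2[OF s, of "\<lambda>s. G (x + s *\<^sub>R u)" "\<lambda>s. G' (x + s *\<^sub>R u) u", OF line] by blast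
    then have "G (x + ?s *\<^sub>R u) - G x = ?s * G' (x + z *\<^sub>R u) u" by (simp only: diff_0_right scaleR_zero_left add_0_right)
    then have "D n x = G' (x + z *\<^sub>R u) u" unfolding D_def by (simp only: nonzero_mult_div_cancel_left[OF less_imp_neq[OF s, symmetric]])
    then show ?thesis using M by simp
  qed
  have zeroD: "D n x = 0" if "norm x > R + norm u" for n x
  proof -
    let ?s = "inverse (real (Suc n))"
    have "norm (?s *\<^sub>R u) \<le> norm u"
      by (simp add: mult_left_le_one_le inverse_le_1_iff)
    then have "norm (x + ?s *\<^sub>R u) > R"
      using that norm_triangle_ineq2[of x "- (?s *\<^sub>R u)"] by simp
    moreover have "norm x > R" using that norm_ge_zero[of u] by linarith
    ultimately show ?thesis
      using R zero unfolding D_def by (metis diff_self div_0 linorder_not_le)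
  qed
  have shift: "integrable lborel (\<lambda>x. G (x + c))"
    "integral\<^sup>L lborel (\<lambda>x. G (x + c)) = integral\<^sup>L lborel G" for c
  proof -
    have mG: "G \<in> borel_measurable borel" using contG by (rule borel_measurable_continuous_onI)
    have "integrable (distr lborel borel ((+) c)) G"
      using ind[OF contG zero] lborel_distr_plus[of c] by simp
    then show "integrable lborel (\<lambda>x. G (x + c))"
      using mG by (subst (asm) integrable_distr_eq) (auto simp: add.commute)
    have "integral\<^sup>L (distr lborel borel ((+) c)) G = integral\<^sup>L lborel (\<lambda>x. G (c + x))"
      using mG by (intro integral_distr) auto
    then show "integral\<^sup>L lborel (\<lambda>x. G (x + c)) = integral\<^sup>L lborel G"
      using lborel_distr_plus[of c] by (simp add: add.commute)
  qed
  have intD: "integral\<^sup>L lborel (D n) = 0" for n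
    unfolding D_def using shift(2)[of 0] shift ind[OF contG zero]
    by (simp add: Bochner_Integration.integral_diff)
  have "(\<lambda>n. integral\<^sup>L lborel (D n)) \<longlonglongrightarrow> integral\<^sup>L lborel (\<lambda>x. G' x u)"
  proof (rule integral_dominated_convergence)
    show "(\<lambda>x. G' x u) \<in> borel_measurable lborel"
      using borel_measurable_continuous_onI[OF cont] by simp
    show "D n \<in> borel_measurable lborel" for n
      unfolding D_def by (intro borel_measurable_divide borel_measurable_diff borel_measurable_const
        borel_measurable_integrable shift(1) ind[OF contG zero])
    show "integrable lborel (\<lambda>x. indicator (cball 0 (R + norm u)) x *\<^sub>R M)"
      by (rule borel_integrable_compact) auto
    show "AE x in lborel. norm (D n x) \<le> indicator (cball 0 (R + norm u)) x *\<^sub>R M" for n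
    proof (rule AE_I2)
      fix x
      show "norm (D n x) \<le> indicator (cball 0 (R + norm u)) x *\<^sub>R M"
        using boundD[of n x] zeroD[of x n] by (cases "norm x \<le> R + norm u") simp_all
    qed
  qed (use limD in auto)
  then show "integral\<^sup>L lborel (\<lambda>x. G' x u) = 0"
    by (simp add: intD LIMSEQ_const_iff)
qed

text \<open>Only the scalar \<open>\<kappa>\<close> needs compact support; the field
  \<open>Y\<close> may grow. The product of \<open>\<kappa>\<close> with the b-component of
  \<open>Y\<close> is differentiated along b, and the results are summed over the basis.\<close>

lemma integral_divergence:
  fixes Y :: "'a::euclidean_space \<Rightarrow> 'a" and \<kappa> :: "'a \<Rightarrow> real"
  assumes Y: "\<And>x. (Y has_derivative Y' x) (at x)" and Y': "\<And>b. continuous_on UNIV (\<lambda>x. Y' x b)"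
    and \<kappa>: "\<And>x. (\<kappa> has_derivative \<kappa>' x) (at x)" and \<kappa>': "\<And>b. continuous_on UNIV (\<lambda>x. \<kappa>' x b)"
    and K: "compact K" and zero: "\<And>x. x \<notin> K \<Longrightarrow> \<kappa> x = 0"
  shows "integrable lborel (\<lambda>x. \<kappa>' x (Y x) + \<kappa> x * (\<Sum>b\<in>Basis. Y' x b \<bullet> b))"
    and "integral\<^sup>L lborel (\<lambda>x. \<kappa>' x (Y x) + \<kappa> x * (\<Sum>b\<in>Basis. Y' x b \<bullet> b)) = 0"
proof -
  have cY: "continuous_on UNIV Y" and c\<kappa>: "continuous_on UNIV \<kappa>"
    by (auto intro!: continuous_at_imp_continuous_on has_derivative_continuous[OF Y] has_derivative_continuous[OF \<kappa>])
  let ?f = "\<lambda>b x. \<kappa>' x b * (Y x \<bullet> b) + \<kappa> x * (Y' x b \<bullet> b)"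
  have *: "integrable lborel (?f b) \<and> integral\<^sup>L lborel (?f b) = 0" for b
  proof -
    have d: "((\<lambda>x. \<kappa> x * (Y x \<bullet> b)) has_derivative
        (\<lambda>u. \<kappa>' x u * (Y x \<bullet> b) + \<kappa> x * (Y' x u \<bullet> b))) (at x)" for x
      by (auto intro!: derivative_eq_intros \<kappa> Y simp: algebra_simps)
    have "continuous_on UNIV (?f b)"
      by (intro continuous_intros cY c\<kappa> Y' \<kappa>')
    then show ?thesis
      using integral_directional_derivative[OF d _ K, of b] zero by simp
  qed
  have eq: "\<kappa>' x (Y x) + \<kappa> x * (\<Sum>b\<in>Basis. Y' x b \<bullet> b) = (\<Sum>b\<in>Basis. ?f b x)" for x
  proof -
    have "\<kappa>' x (Y x) = \<kappa>' x (\<Sum>b\<in>Basis. (Y x \<bullet> b) *\<^sub>R b)" by (simp add: euclidean_representation)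
    also have "\<dots> = (\<Sum>b\<in>Basis. \<kappa>' x b * (Y x \<bullet> b))"
      using has_derivative_linear[OF \<kappa>[of x]] by (simp add: linear_sum linear_scale mult.commute)
    finally show ?thesis by (simp add: sum.distrib sum_distrib_left)
  qed
  show "integrable lborel (\<lambda>x. \<kappa>' x (Y x) + \<kappa> x * (\<Sum>b\<in>Basis. Y' x b \<bullet> b))"
    unfolding eq using * by (intro Bochner_Integration.integrable_sum) auto
  show "integral\<^sup>L lborel (\<lambda>x. \<kappa>' x (Y x) + \<kappa> x * (\<Sum>b\<in>Basis. Y' x b \<bullet> b)) = 0"
    unfolding eq using * by (subst Bochner_Integration.integral_sum) auto
qed

text \<open>Cyclicity of the trace, by expanding \<open>A' b\<close> in the basis and resumming. It
  carries a divergence computed at the identity to an arbitrary base point.\<close>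

lemma trace_conjugate:
  fixes A A' D :: "'a::euclidean_space \<Rightarrow> 'a"
  assumes "linear A" "linear A'" "linear D" and inv: "\<And>u. A' (A u) = u"
  shows "(\<Sum>b\<in>Basis. A (D (A' b)) \<bullet> b) = (\<Sum>b\<in>Basis. D b \<bullet> b)"
proof -
  have "A (D (A' b)) = (\<Sum>c\<in>Basis. (A' b \<bullet> c) *\<^sub>R A (D c))" for b
  proof -
    have "A (D (A' b)) = A (D (\<Sum>c\<in>Basis. (A' b \<bullet> c) *\<^sub>R c))" by (simp add: euclidean_representation)
    then show ?thesis using assms by (simp add: linear_sum linear_scale)
  qed
  then have "(\<Sum>b\<in>Basis. A (D (A' b)) \<bullet> b) = (\<Sum>b\<in>Basis. \<Sum>c\<in>Basis. (A' b \<bullet> c) * (A (D c) \<bullet> b))"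
    by (simp add: inner_sum_left)
  also have "\<dots> = (\<Sum>c\<in>Basis. (\<Sum>b\<in>Basis. (A (D c) \<bullet> b) *\<^sub>R A' b) \<bullet> c)"
    by (subst sum.swap) (simp add: inner_sum_left mult.commute)
  also have "\<dots> = (\<Sum>c\<in>Basis. A' (\<Sum>b\<in>Basis. (A (D c) \<bullet> b) *\<^sub>R b) \<bullet> c)"
    using assms by (simp add: linear_sum linear_scale)
  also have "\<dots> = (\<Sum>c\<in>Basis. D c \<bullet> c)" by (simp add: euclidean_representation inv)
  finally show ?thesis .
qed

section \<open>Powers of the absolute value and Young's inequality\<close>

lemma has_real_derivative_abs_powr:
  fixes P t :: real
  assumes "P > 1"
  shows "((\<lambda>t. \<bar>t\<bar> powr P) has_real_derivative P * \<bar>t\<bar> powr (P - 1) * sgn t) (at t)"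
proof (cases "t = 0")
  case True
  \<comment> \<open>At the origin the difference quotient has modulus
    \<open>\<bar>d\<bar> powr (P - 1)\<close>, which tends to 0 because P > 1.\<close>
  have "((\<lambda>d::real. \<bar>\<bar>d\<bar> powr P / d\<bar>) \<longlongrightarrow> 0) (at 0)"
  proof (rule Lim_transform_eventually)
    have "((\<lambda>d::real. \<bar>d\<bar> powr (P - 1)) \<longlongrightarrow> \<bar>0\<bar> powr (P - 1)) (at 0)"
      using assms by (intro tendsto_powr' tendsto_rabs tendsto_ident_at tendsto_const) auto
    then show "((\<lambda>d::real. \<bar>d\<bar> powr (P - 1)) \<longlongrightarrow> 0) (at 0)" by simp
    show "\<forall>\<^sub>F d::real in at 0. \<bar>d\<bar> powr (P - 1) = \<bar>\<bar>d\<bar> powr P / d\<bar>"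
      by (rule eventually_at_filter[THEN iffD2], rule always_eventually) (auto simp: powr_diff abs_mult abs_divide)
  qed
  then have "((\<lambda>d::real. \<bar>d\<bar> powr P / d) \<longlongrightarrow> 0) (at 0)" by (rule tendsto_rabs_zero_cancel)
  then show ?thesis
    using True assms by (simp add: has_field_derivative_iff)
next
  case False
  then consider "t > 0" | "t < 0" by linarith
  then show ?thesis
  proof cases
    case 1
    have "((\<lambda>t. t powr P) has_real_derivative P * t powr (P - 1)) (at t)"
      using 1 by (auto intro!: derivative_eq_intros simp: powr_diff)
    then have "((\<lambda>t. \<bar>t\<bar> powr P) has_real_derivative P * t powr (P - 1)) (at t)"
      by (rule has_field_derivative_transform_within_open[of _ _ _ "{0<..}"]) (use 1 in auto)
    then show ?thesis using 1 by simp
  next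
    case 2
    have "((\<lambda>t. (- t) powr P) has_real_derivative P * (- t) powr (P - 1) * (- 1)) (at t)"
      using 2 by (auto intro!: derivative_eq_intros simp: powr_diff)
    then have "((\<lambda>t. \<bar>t\<bar> powr P) has_real_derivative P * (- t) powr (P - 1) * (- 1)) (at t)"
      by (rule has_field_derivative_transform_within_open[of _ _ _ "{..<0}"]) (use 2 in auto)
    then show ?thesis using 2 by simp
  qed
qed

lemma continuous_on_abs_powr_sgn:
  fixes P :: real
  assumes "P > 0"
  shows "continuous_on UNIV (\<lambda>t::real. \<bar>t\<bar> powr P * sgn t)"
proof -
  have "continuous (at t) (\<lambda>t::real. \<bar>t\<bar> powr P * sgn t)" for t :: real
  proof (cases "t = 0")
    case True
    have "((\<lambda>t::real. \<bar>t\<bar> powr P) \<longlongrightarrow> \<bar>0\<bar> powr P) (at 0)"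
      using assms by (intro tendsto_powr' tendsto_rabs tendsto_ident_at tendsto_const) auto
    then have "((\<lambda>t::real. \<bar>t\<bar> powr P * sgn t) \<longlongrightarrow> 0) (at 0)"
      by (intro tendsto_rabs_zero_cancel[of "\<lambda>t. \<bar>t\<bar> powr P * sgn t"])
        (rule tendsto_sandwich[of "\<lambda>_. 0" _ _ "\<lambda>t::real. \<bar>t\<bar> powr P"], auto simp: abs_mult abs_sgn_eq)
    then show ?thesis using True by (simp add: continuous_at)
  next
    case False
    then show ?thesis by (auto intro!: continuous_intros)
  qed
  then show ?thesis by (simp add: continuous_at_imp_continuous_on)
qed

text \<open>Young's inequality for the conjugate exponents P and P / (P - 1), multiplied by P so
  that it absorbs the factor P coming from the derivative of
  \<open>\<bar>\<phi>\<bar> powr P\<close>.\<close>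

lemma young_powr:
  fixes P x y :: real
  assumes "P > 1" "x \<ge> 0" "y \<ge> 0"
  shows "P * x * y \<le> x powr P + (P - 1) * y powr (P / (P - 1))"
  using Youngs_inequality[of P "P / (P - 1)" x y] assms
  by (simp add: field_simps)

section \<open>The function \<open>cosh\<^sup>2 (r / 2)\<close>\<close>

text \<open>\<open>Htype\<close> provides J_Z only existentially and for each Z separately. The
  explicit formula gives one operator that is visibly bilinear in Z and V; \<open>J_unique\<close>
  identifies the two.\<close>

definition DR_J :: "('v::euclidean_space \<Rightarrow> 'v \<Rightarrow> 'z::euclidean_space) \<Rightarrow> 'z \<Rightarrow> 'v \<Rightarrow> 'v" where
  "DR_J br Z V = (\<Sum>b\<in>Basis. (Z \<bullet> br V b) *\<^sub>R b)"

definition DR_frame :: "('v::euclidean_space \<Rightarrow> 'v \<Rightarrow> 'z::euclidean_space) \<Rightarrow>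
    ('v \<times> 'z \<times> real) \<Rightarrow> ('v \<times> 'z \<times> real) \<Rightarrow> ('v \<times> 'z \<times> real)" where
  "DR_frame br x u = (exp (snd (snd x) / 2) *\<^sub>R fst u,
     exp (snd (snd x)) *\<^sub>R fst (snd u) + (1/2) *\<^sub>R br (fst x) (exp (snd (snd x) / 2) *\<^sub>R fst u), snd (snd u))"

lemma DR_mc_alt:
  "DR_mc br x u = (exp (- snd (snd x) / 2) *\<^sub>R fst u,
     exp (- snd (snd x)) *\<^sub>R (fst (snd u) - (1/2) *\<^sub>R br (fst x) (fst u)), snd (snd u))"
  by (simp add: DR_mc_def split: prod.split)

text \<open>\<open>DR_w x\<close> is \<open>cosh\<^sup>2 (r / 2)\<close> for the distance \<open>r\<close> of \<open>x\<close> from the identity; \<open>DR_w'\<close> is its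
  differential and \<open>DR_grad_w\<close> its Riemannian gradient in coordinates.\<close>
definition DR_u :: "('v::euclidean_space \<times> 'z::euclidean_space \<times> real) \<Rightarrow> real" where
  "DR_u x = 1 + exp (snd (snd x)) + (fst x \<bullet> fst x) / 4"

definition DR_w :: "('v::euclidean_space \<times> 'z::euclidean_space \<times> real) \<Rightarrow> real" where
  "DR_w x = ((DR_u x)\<^sup>2 + fst (snd x) \<bullet> fst (snd x)) / (4 * exp (snd (snd x)))"

definition DR_w' :: "('v::euclidean_space \<times> 'z::euclidean_space \<times> real) \<Rightarrow>
    ('v \<times> 'z \<times> real) \<Rightarrow> real" where
  "DR_w' x d = (DR_u x * (fst x \<bullet> fst d) / 4 + fst (snd x) \<bullet> fst (snd d) / 2) / exp (snd (snd x))
     + (DR_u x / 2 - DR_w x) * snd (snd d)"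

definition DR_grad_w :: "('v::euclidean_space \<Rightarrow> 'v \<Rightarrow> 'z::euclidean_space) \<Rightarrow>
    ('v \<times> 'z \<times> real) \<Rightarrow> ('v \<times> 'z \<times> real)" where
  "DR_grad_w br x = ((1/4) *\<^sub>R (DR_u x *\<^sub>R fst x + DR_J br (fst (snd x)) (fst x)),
     (exp (snd (snd x)) / 2 + (fst x \<bullet> fst x) / 8) *\<^sub>R fst (snd x), DR_u x / 2 - DR_w x)"

definition DR_grad_w' :: "('v::euclidean_space \<Rightarrow> 'v \<Rightarrow> 'z::euclidean_space) \<Rightarrow>
    ('v \<times> 'z \<times> real) \<Rightarrow> ('v \<times> 'z \<times> real) \<Rightarrow> ('v \<times> 'z \<times> real)" where
  "DR_grad_w' br x d =
     ((1/4) *\<^sub>R ((exp (snd (snd x)) * snd (snd d) + (fst x \<bullet> fst d) / 2) *\<^sub>R fst x + DR_u x *\<^sub>R fst d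
        + DR_J br (fst (snd d)) (fst x) + DR_J br (fst (snd x)) (fst d)),
      (exp (snd (snd x)) * snd (snd d) / 2 + (fst x \<bullet> fst d) / 4) *\<^sub>R fst (snd x)
        + (exp (snd (snd x)) / 2 + (fst x \<bullet> fst x) / 8) *\<^sub>R fst (snd d),
      (exp (snd (snd x)) * snd (snd d) + (fst x \<bullet> fst d) / 2) / 2 - DR_w' x d)"

lemma DR_u_has_derivative:
  "(DR_u has_derivative (\<lambda>d. exp (snd (snd x)) * snd (snd d) + (fst x \<bullet> fst d) / 2)) (at x)"
proof -
  have "(DR_u has_derivative (\<lambda>d. exp (snd (snd x)) * snd (snd d) + (fst x \<bullet> fst d + fst d \<bullet> fst x) / 4)) (at x)"
    unfolding DR_u_def[abs_def] by (auto intro!: derivative_eq_intros)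
  then show ?thesis by (simp add: inner_commute)
qed

lemma DR_w_has_derivative: "(DR_w has_derivative DR_w' x) (at x)"
proof -
  note DR_u_has_derivative[derivative_intros]
  have eq: "DR_w = (\<lambda>x. ((DR_u x)\<^sup>2 + fst (snd x) \<bullet> fst (snd x)) * exp (- snd (snd x)) / 4)"
    by (auto simp: DR_w_def exp_minus field_simps)
  have "(DR_w has_derivative (\<lambda>d. (2 * DR_u x * (exp (snd (snd x)) * snd (snd d) + (fst x \<bullet> fst d) / 2)
      + 2 * (fst (snd x) \<bullet> fst (snd d))) * exp (- snd (snd x)) / 4
     - ((DR_u x)\<^sup>2 + fst (snd x) \<bullet> fst (snd x)) * exp (- snd (snd x)) / 4 * snd (snd d))) (at x)"
    unfolding eq
    by (rule derivative_eq_intros refl | simp)+ (simp add: fun_eq_iff inner_commute field_simps)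
  moreover have "(\<lambda>d. (2 * DR_u x * (exp (snd (snd x)) * snd (snd d) + (fst x \<bullet> fst d) / 2)
      + 2 * (fst (snd x) \<bullet> fst (snd d))) * exp (- snd (snd x)) / 4
     - ((DR_u x)\<^sup>2 + fst (snd x) \<bullet> fst (snd x)) * exp (- snd (snd x)) / 4 * snd (snd d)) = DR_w' x"
    unfolding DR_w'_def DR_w_def by (auto simp: exp_minus field_simps)
  ultimately show ?thesis by simp
qed

text \<open>Expanding (1 + a + c/4)^2 - 4a, with a = exp t and c the square of the norm of V, leaves
  only nonnegative terms, so both the bound w >= 1 and its equality case can be read off.\<close>

lemma DR_w_minus_1:
  "DR_w x - 1 = ((exp (snd (snd x)) - 1)\<^sup>2 + (1 + exp (snd (snd x))) * (fst x \<bullet> fst x) / 2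
     + (fst x \<bullet> fst x)\<^sup>2 / 16 + fst (snd x) \<bullet> fst (snd x)) / (4 * exp (snd (snd x)))"
  by (simp add: DR_w_def DR_u_def field_simps power2_eq_square)

lemma DR_w_ge_1: "DR_w x \<ge> 1"
proof -
  have "DR_w x - 1 \<ge> 0"
    unfolding DR_w_minus_1 by (intro divide_nonneg_pos add_nonneg_nonneg mult_nonneg_nonneg) auto
  then show ?thesis by simp
qed

lemma DR_w_eq_1_iff: "DR_w x = 1 \<longleftrightarrow> x = 0"
proof
  assume "DR_w x = 1"
  then have *: "(exp (snd (snd x)) - 1)\<^sup>2 + (1 + exp (snd (snd x))) * (fst x \<bullet> fst x) / 2
     + (fst x \<bullet> fst x)\<^sup>2 / 16 + fst (snd x) \<bullet> fst (snd x) = 0"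
    using DR_w_minus_1[of x] by simp
  have nn: "a = 0 \<and> c = 0 \<and> d = 0"
    if "a + b + c + d = 0" "a \<ge> 0" "b \<ge> 0" "c \<ge> 0" "d \<ge> 0" for a b c d :: real
    using that by arith
  have "(exp (snd (snd x)) - 1)\<^sup>2 = 0 \<and> (fst x \<bullet> fst x)\<^sup>2 / 16 = 0 \<and> fst (snd x) \<bullet> fst (snd x) = 0"
    by (rule nn[OF *]; intro divide_nonneg_nonneg mult_nonneg_nonneg add_nonneg_nonneg zero_le_power2 inner_ge_zero
      exp_ge_zero zero_le_one zero_le_numeral)
  then show "x = 0" by (simp add: prod_eq_iff)
qed (simp add: DR_w_def DR_u_def)

lemma sum_Basis_prod:
  fixes f :: "'a::euclidean_space \<times> 'b::euclidean_space \<Rightarrow> real"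
  shows "(\<Sum>b\<in>Basis. f b) = (\<Sum>b\<in>Basis. f (b, 0)) + (\<Sum>b\<in>Basis. f (0, b))"
proof -
  have "inj_on (\<lambda>u. (u::'a, 0::'b)) Basis" "inj_on (\<lambda>u. (0::'a, u::'b)) Basis"
    by (auto intro!: inj_onI)
  then show ?thesis
    unfolding Basis_prod_def by (subst sum.union_disjoint) (auto simp: sum.reindex)
qed

text \<open>\<open>DR_frame br x\<close>, the inverse of \<open>DR_mc br x\<close>, is also the linear part of left translation by \<open>x\<close>; hence
  \<open>DR_mc br x0 (x - x0)\<close> is \<open>x0\<^sup>-\<^sup>1 x\<close> in the group.\<close>
locale H_type =
  fixes br :: "'v::euclidean_space \<Rightarrow> 'v \<Rightarrow> 'z::euclidean_space"
  assumes Htype: "Htype br"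
begin

section \<open>Linear algebra of the H-type bracket\<close>

lemma bilinear_br: "bilinear br" and br_skew: "br x y = - br y x"
  using Htype unfolding Htype_def by blast+

lemma br_self [simp]: "br x x = 0"
proof -
  have "br x x + br x x = br x x + (- br x x)" using br_skew[of x x] by presburger
  then have "2 *\<^sub>R br x x = 0" unfolding scaleR_2 by simp
  then show ?thesis by simp
qed

lemmas br_simps = bilinear_ladd[OF bilinear_br] bilinear_radd[OF bilinear_br]
  bilinear_lmul[OF bilinear_br] bilinear_rmul[OF bilinear_br]
  bilinear_lsub[OF bilinear_br] bilinear_rsub[OF bilinear_br]
  bilinear_lneg[OF bilinear_br] bilinear_rneg[OF bilinear_br]
  bilinear_lzero[OF bilinear_br] bilinear_rzero[OF bilinear_br]

lemma inner_J: "DR_J br Z V \<bullet> V' = Z \<bullet> br V V'"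
proof -
  have "br V V' = (\<Sum>b\<in>Basis. (V' \<bullet> b) *\<^sub>R br V b)"
  proof -
    have l: "linear (br V)" using bilinear_br by (simp add: bilinear_def)
    have "br V V' = br V (\<Sum>b\<in>Basis. (V' \<bullet> b) *\<^sub>R b)" by (simp add: euclidean_representation)
    then show ?thesis using l by (simp add: linear_sum linear_scale)
  qed
  then show ?thesis
    by (simp add: DR_J_def inner_sum_left inner_sum_right inner_commute mult.commute)
qed

lemma J_unique:
  assumes "\<And>V V'. J V \<bullet> V' = Z \<bullet> br V V'"
  shows "J = DR_J br Z"
proof
  fix V
  have "\<forall>V'. J V \<bullet> V' = DR_J br Z V \<bullet> V'" by (simp only: assms inner_J) simp
  then show "J V = DR_J br Z V" by (simp only: vector_eq_rdot)
qed

lemma J_J: "DR_J br Z (DR_J br Z V) = - (Z \<bullet> Z) *\<^sub>R V"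
proof -
  obtain J where "\<forall>V V'. J V \<bullet> V' = Z \<bullet> br V V'" "\<forall>V. J (J V) = - ((norm Z)\<^sup>2) *\<^sub>R V"
    using Htype unfolding Htype_def by blast
  note J = this
  have "J = DR_J br Z" using J(1) by (intro J_unique) blast
  with J(2) have "DR_J br Z (DR_J br Z V) = - ((norm Z)\<^sup>2) *\<^sub>R V" by blast
  then show ?thesis by (simp only: power2_norm_eq_inner)
qed

lemma inner_J_left: "V' \<bullet> DR_J br Z V = Z \<bullet> br V V'"
  unfolding inner_J[symmetric] by (rule inner_commute)

lemma bilinear_J: "bilinear (DR_J br)"
  unfolding bilinear_def linear_iff vector_eq_rdot[where 'a = 'v, symmetric]
  by (auto simp: inner_J inner_add_left br_simps inner_add_right)

lemmas J_simps = bilinear_ladd[OF bilinear_J] bilinear_radd[OF bilinear_J]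
  bilinear_lmul[OF bilinear_J] bilinear_rmul[OF bilinear_J]
  bilinear_lzero[OF bilinear_J] bilinear_rzero[OF bilinear_J]
  bilinear_rsub[OF bilinear_J]

lemma inner_J_self [simp]: "DR_J br Z V \<bullet> V = 0" "V \<bullet> DR_J br Z V = 0"
  by (simp_all add: inner_J inner_J_left)

lemma J_skew: "DR_J br Z V \<bullet> V' = - (V \<bullet> DR_J br Z V')"
  unfolding inner_J inner_J_left by (subst br_skew) simp

text \<open>Polarising J_Z^2 = - |Z|^2 in Z gives J_Z J_\<zeta> + J_\<zeta> J_Z = - 2 <Z, \<zeta>>.
  By skewness <J_\<zeta> V, J_Z V> = <Z, \<zeta>> |V|^2, and the left side is the \<zeta>-component
  of [V, J_Z V].\<close>

lemma br_J: "br V (DR_J br Z V) = (V \<bullet> V) *\<^sub>R Z"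
proof (rule vector_eq_rdot[THEN iffD1], intro allI)
  fix \<zeta>
  have "DR_J br (Z + \<zeta>) (DR_J br (Z + \<zeta>) V) \<bullet> V = - ((Z + \<zeta>) \<bullet> (Z + \<zeta>)) * (V \<bullet> V)"
    by (simp add: J_J)
  then have "DR_J br Z (DR_J br \<zeta> V) \<bullet> V + DR_J br \<zeta> (DR_J br Z V) \<bullet> V = - 2 * (Z \<bullet> \<zeta>) * (V \<bullet> V)"
    by (simp add: J_simps J_J algebra_simps inner_add_left inner_commute)
  then have "DR_J br \<zeta> V \<bullet> DR_J br Z V = (Z \<bullet> \<zeta>) * (V \<bullet> V)"
    using J_skew[of Z "DR_J br \<zeta> V" V] J_skew[of \<zeta> "DR_J br Z V" V]
      inner_commute[of "DR_J br \<zeta> V" "DR_J br Z V"] by simp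
  moreover have "br V (DR_J br Z V) \<bullet> \<zeta> = DR_J br \<zeta> V \<bullet> DR_J br Z V"
    by (metis inner_J inner_commute)
  ultimately show "br V (DR_J br Z V) \<bullet> \<zeta> = ((V \<bullet> V) *\<^sub>R Z) \<bullet> \<zeta>"
    by simp
qed

lemma inner_J_J: "DR_J br Z V \<bullet> DR_J br Z V = (Z \<bullet> Z) * (V \<bullet> V)"
  by (simp add: inner_J br_J)

section \<open>The left-invariant frame, and the gradient and Laplacian of
  \<open>DR_w\<close>\<close>

lemma linear_mc: "linear (DR_mc br x)"
  by (rule linearI) (auto simp: DR_mc_alt br_simps algebra_simps)

lemma linear_frame: "linear (DR_frame br x)"
  by (rule linearI) (auto simp: DR_frame_def br_simps algebra_simps)

lemma exp_half:
  fixes t :: real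
  shows "exp t = (exp (t / 2))\<^sup>2" "exp (- t / 2) = inverse (exp (t / 2))" "exp (- t) = inverse ((exp (t / 2))\<^sup>2)"
  by (simp_all add: exp_minus flip: exp_double)

lemma mc_frame [simp]: "DR_mc br x (DR_frame br x u) = u"
  by (simp add: DR_mc_alt DR_frame_def prod_eq_iff exp_minus)

lemma frame_mc [simp]: "DR_frame br x (DR_mc br x u) = u"
  by (simp add: DR_mc_alt DR_frame_def prod_eq_iff exp_minus)

text \<open>Left translations are affine in these coordinates, so the differential of translation by
  the inverse of \<open>x0\<close> is the constant map \<open>DR_mc br x0\<close>; the identity says
  that it is an isometry. This reduces every base point to the identity element.\<close>

lemma mc_left_invariant:
  "DR_mc br (DR_mc br x0 (x - x0)) (DR_mc br x0 u) = DR_mc br x u"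
proof -
  define s s0 where "s = exp (snd (snd x) / 2)" and "s0 = exp (snd (snd x0) / 2)"
  have pos: "s > 0" "s0 > 0" by (auto simp: s_def s0_def)
  have d: "exp ((snd (snd x) - snd (snd x0)) / 2) = s / s0"
    by (simp add: s_def s0_def diff_divide_distrib exp_diff)
  have "exp (- (snd (snd x) - snd (snd x0)) / 2) = s0 / s"
    "exp (- (snd (snd x) - snd (snd x0))) = s0\<^sup>2 / s\<^sup>2"
    using d exp_half(2,3)[of "snd (snd x) - snd (snd x0)"] by (auto simp: power_divide)
  moreover have "exp (- snd (snd x) / 2) = 1 / s" "exp (- snd (snd x)) = 1 / s\<^sup>2"
    "exp (- snd (snd x0) / 2) = 1 / s0" "exp (- snd (snd x0)) = 1 / s0\<^sup>2"
    using exp_half(2,3)[of "snd (snd x)"] exp_half(2,3)[of "snd (snd x0)"]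
    by (auto simp: s_def s0_def inverse_eq_divide)
  ultimately show ?thesis
    using pos by (simp add: DR_mc_alt br_simps scaleR_diff_right power2_eq_square)
qed

text \<open>This is what makes \<open>DR_grad_w\<close> the Riemannian gradient: the bracket terms
  from the v-part and from the z-part cancel, leaving the differential of
  \<open>DR_w\<close>.\<close>

lemma DR_w'_eq_inner: "DR_w' x d = DR_mc br x (DR_grad_w br x) \<bullet> DR_mc br x d"
proof -
  define c where "c = exp (- snd (snd x) / 2)"
  have cc: "c * c = inverse (exp (snd (snd x)))" unfolding c_def by (simp flip: exp_add exp_minus)
  \<comment> \<open>Half of [V, J_Z V / 4] is |V|^2 Z / 8 by \<open>br_J\<close>; this is exactly
    the extra summand in the middle component of \<open>DR_grad_w\<close>, so only Z / 2 survives in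
    the frame.\<close>
  have mcg: "DR_mc br x (DR_grad_w br x) = (c *\<^sub>R (1/4) *\<^sub>R (DR_u x *\<^sub>R fst x + DR_J br (fst (snd x)) (fst x)),
     (1/2) *\<^sub>R fst (snd x), DR_u x / 2 - DR_w x)"
    by (simp add: c_def DR_mc_alt DR_grad_w_def br_simps br_J exp_minus field_simps flip: scaleR_diff_left)
  have mcd: "DR_mc br x d = (c *\<^sub>R fst d, inverse (exp (snd (snd x))) *\<^sub>R
      (fst (snd d) - (1/2) *\<^sub>R br (fst x) (fst d)), snd (snd d))"
    by (simp add: DR_mc_alt c_def exp_minus)
  have "DR_mc br x (DR_grad_w br x) \<bullet> DR_mc br x d = (c * c) * (DR_u x * (fst x \<bullet> fst d) + fst (snd x) \<bullet> br (fst x) (fst d)) / 4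
     + inverse (exp (snd (snd x))) * (fst (snd x) \<bullet> fst (snd d) - fst (snd x) \<bullet> br (fst x) (fst d) / 2) / 2
     + (DR_u x / 2 - DR_w x) * snd (snd d)"
    unfolding mcg mcd by (simp add: inner_add_left inner_J inner_diff_right) (simp add: algebra_simps diff_divide_distrib)
  also have "\<dots> = DR_w' x d"
    unfolding cc by (simp add: DR_w'_def field_simps)
  finally show ?thesis ..
qed

text \<open>In terms of r this is |grad r| = 1, since the derivative of cosh^2(r/2) is cosh(r/2)
  sinh(r/2), with square w (w - 1). The J-term drops out because J_Z V is orthogonal to V.\<close>

lemma DR_w'_grad: "DR_w' x (DR_grad_w br x) = (DR_w x)\<^sup>2 - DR_w x"
proof -
  define a b c where "a = exp (snd (snd x))" and "b = fst (snd x) \<bullet> fst (snd x)" and "c = fst x \<bullet> fst x"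
  have a: "a > 0" by (simp add: a_def)
  have u: "DR_u x = 1 + a + c / 4" and w: "DR_w x = ((DR_u x)\<^sup>2 + b) / (4 * a)"
    by (auto simp: DR_u_def DR_w_def a_def b_def c_def)
  have "DR_w' x (DR_grad_w br x) = (DR_u x * (DR_u x * c / 4) / 4 + (a / 2 + c / 8) * b / 2) / a
     + (DR_u x / 2 - DR_w x)\<^sup>2"
    by (simp add: DR_w'_def DR_grad_w_def inner_add_right a_def b_def c_def power2_eq_square)
  also have "\<dots> = (DR_w x)\<^sup>2 - DR_w x"
    unfolding w using a u by (simp add: field_simps power2_eq_square) algebra
  finally show ?thesis .
qed

lemma norm_mc_grad: "(norm (DR_mc br x (DR_grad_w br x)))\<^sup>2 = (DR_w x)\<^sup>2 - DR_w x"
  using DR_w'_eq_inner[of x "DR_grad_w br x"] DR_w'_grad by (simp add: power2_norm_eq_inner)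

lemma DR_grad_w_has_derivative: "(DR_grad_w br has_derivative DR_grad_w' br x) (at x)"
proof -
  note DR_u_has_derivative[derivative_intros] DR_w_has_derivative[derivative_intros]
  interpret J: bounded_bilinear "DR_J br" using bilinear_J by (simp add: bilinear_conv_bounded_bilinear)
  show ?thesis
    unfolding DR_grad_w_def[abs_def] DR_grad_w'_def[abs_def]
    by (auto intro!: derivative_eq_intros J.FDERIV simp: algebra_simps inner_commute add_divide_distrib)
qed

text \<open>The volume density exp (- (p/2 + q) t) makes the Riemannian divergence equal to the
  coordinate trace minus (p/2 + q) times the t-component, so the left side is \<Delta>w. The J-terms
  have zero diagonal by skewness.\<close>

lemma trace_DR_grad_w':
  fixes x :: "'v \<times> 'z \<times> real"
  shows "(\<Sum>b\<in>Basis. DR_grad_w' br x b \<bullet> b) - (real DIM('v) / 2 + real DIM('z)) * (DR_u x / 2 - DR_w x)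
    = (1 + real DIM('v) / 2 + real DIM('z)) * DR_w x - (real DIM('z) + 1) / 2"
proof -
  have v: "DR_grad_w' br x (b, 0) \<bullet> (b, 0) = (fst x \<bullet> b)\<^sup>2 / 8 + DR_u x / 4" if "b \<in> Basis" for b :: 'v
    using that by (simp add: DR_grad_w'_def inner_add_left power2_eq_square J_simps)
  have z: "DR_grad_w' br x (0, b, 0) \<bullet> (0, b, 0) = exp (snd (snd x)) / 2 + (fst x \<bullet> fst x) / 8" if "b \<in> Basis" for b :: 'z
    using that by (simp add: DR_grad_w'_def inner_add_left power2_eq_square)
  have t: "DR_grad_w' br x (0, 0, 1) \<bullet> (0, 0, 1) = exp (snd (snd x)) / 2 - (DR_u x / 2 - DR_w x)"
    by (simp add: DR_grad_w'_def DR_w'_def)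
  have "(\<Sum>b\<in>Basis. (fst x \<bullet> b)\<^sup>2) = fst x \<bullet> fst x"
    by (subst euclidean_inner) (simp add: power2_eq_square)
  then have sv: "(\<Sum>b\<in>Basis. DR_grad_w' br x (b, 0) \<bullet> (b, 0))
      = (fst x \<bullet> fst x) / 8 + real DIM('v) * (DR_u x / 4)"
    by (simp add: sum.cong[OF refl v] sum.distrib flip: sum_divide_distrib)
  have sz: "(\<Sum>b\<in>Basis. DR_grad_w' br x (0, b, 0) \<bullet> (0, b, 0))
      = real DIM('z) * (exp (snd (snd x)) / 2 + (fst x \<bullet> fst x) / 8)"
    by (simp add: sum.cong[OF refl z])
  have "(\<Sum>b\<in>Basis. DR_grad_w' br x b \<bullet> b) =
     (fst x \<bullet> fst x) / 8 + real DIM('v) * (DR_u x / 4) + real DIM('z) * (exp (snd (snd x)) / 2 + (fst x \<bullet> fst x) / 8)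
     + (exp (snd (snd x)) / 2 - (DR_u x / 2 - DR_w x))"
    unfolding sum_Basis_prod[of "\<lambda>b. DR_grad_w' br x b \<bullet> b"]
      sum_Basis_prod[of "\<lambda>b. DR_grad_w' br x (0, b) \<bullet> (0, b)"] sv sz
    by (simp add: t)
  then show ?thesis
    by (simp add: DR_u_def field_simps)
qed

end

section \<open>The distance function\<close>

context H_type
begin

lemma bounded_bilinear_br: "bounded_bilinear br"
  using bilinear_br by (simp add: bilinear_conv_bounded_bilinear)

lemma continuous_on_mc:
  assumes "continuous_on S f" "continuous_on S g"
  shows "continuous_on S (\<lambda>x. DR_mc br (f x) (g x))"
  unfolding DR_mc_alt
  by (intro continuous_intros assms bounded_bilinear.continuous_on[OF bounded_bilinear_br]) auto

lemma continuous_on_frame: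
  assumes "continuous_on S f" "continuous_on S g"
  shows "continuous_on S (\<lambda>x. DR_frame br (f x) (g x))"
  unfolding DR_frame_def
  by (intro continuous_intros assms bounded_bilinear.continuous_on[OF bounded_bilinear_br]) auto

definition dist_w :: "'v \<times> 'z \<times> real \<Rightarrow> 'v \<times> 'z \<times> real \<Rightarrow> real" where
  "dist_w x0 x = DR_w (DR_mc br x0 (x - x0))"

definition dist_w' :: "'v \<times> 'z \<times> real \<Rightarrow> 'v \<times> 'z \<times> real \<Rightarrow> 'v \<times> 'z \<times> real \<Rightarrow> real" where
  "dist_w' x0 x d = DR_w' (DR_mc br x0 (x - x0)) (DR_mc br x0 d)"

lemma mc_diff_has_derivative:
  "((\<lambda>x. DR_mc br x0 (x - x0)) has_derivative DR_mc br x0) (at x)"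
proof -
  have "bounded_linear (DR_mc br x0)" using linear_mc linear_conv_bounded_linear by blast
  moreover have "((\<lambda>x. x - x0) has_derivative (\<lambda>d. d)) (at x)" by (auto intro!: derivative_eq_intros)
  ultimately show ?thesis by (rule bounded_linear.has_derivative)
qed

lemma dist_w_has_derivative: "(dist_w x0 has_derivative dist_w' x0 x) (at x)"
  unfolding dist_w_def[abs_def] dist_w'_def[abs_def]
  by (rule has_derivative_compose[OF mc_diff_has_derivative DR_w_has_derivative])

lemma dist_w_ge_1: "dist_w x0 x \<ge> 1"
  by (simp add: dist_w_def DR_w_ge_1)

lemma mc_eq_0_iff: "DR_mc br x u = 0 \<longleftrightarrow> u = 0"
  by (metis frame_mc linear_0 linear_frame linear_mc)

lemma dist_w_eq_1_iff: "dist_w x0 x = 1 \<longleftrightarrow> x = x0"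
  by (simp add: dist_w_def DR_w_eq_1_iff mc_eq_0_iff)

text \<open>Cauchy-Schwarz against the gradient, whose norm is known. Away from \<open>x0\<close> it
  says that arcosh (2w - 1) changes with speed at most one.\<close>

lemma abs_dist_w'_le: "\<bar>dist_w' x0 x d\<bar> \<le> sqrt ((dist_w x0 x)\<^sup>2 - dist_w x0 x) * norm (DR_mc br x d)"
proof -
  define y where "y = DR_mc br x0 (x - x0)"
  have "\<bar>dist_w' x0 x d\<bar> \<le> norm (DR_mc br y (DR_grad_w br y)) * norm (DR_mc br y (DR_mc br x0 d))"
    unfolding dist_w'_def DR_w'_eq_inner y_def by (rule Cauchy_Schwarz_ineq2)
  also have "norm (DR_mc br y (DR_grad_w br y)) = sqrt ((dist_w x0 x)\<^sup>2 - dist_w x0 x)"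
    unfolding dist_w_def y_def norm_mc_grad[symmetric] by simp
  also have "DR_mc br y (DR_mc br x0 d) = DR_mc br x d"
    unfolding y_def by (rule mc_left_invariant)
  finally show ?thesis .
qed

lemma DR_len_eq:
  assumes "\<And>s. s \<in> {0..1} \<Longrightarrow> (\<gamma> has_vector_derivative D s) (at s)"
  shows "DR_len br \<gamma> = integral {0..1} (\<lambda>s. norm (DR_mc br (\<gamma> s) (D s)))"
  unfolding DR_len_def
proof (rule integral_cong)
  fix s :: real assume s: "s \<in> {0..1}"
  have "vector_derivative \<gamma> (at s within {0..1}) = D s"
    using s assms by (intro vector_derivative_at_within_ivl) auto
  then show "norm (DR_mc br (\<gamma> s) (vector_derivative \<gamma> (at s within {0..1}))) = norm (DR_mc br (\<gamma> s) (D s))"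
    by simp
qed

text \<open>Shifting by \<open>\<delta> > 0\<close> keeps \<open>arcosh\<close> away from its branch point, where it is not differentiable.\<close>
lemma arcosh_dist_w_le_DR_len:
  assumes "\<gamma> C1_differentiable_on {0..1}" "\<gamma> 0 = x0" "\<gamma> 1 = x"
  shows "arcosh (2 * dist_w x0 x - 1) \<le> DR_len br \<gamma>"
proof -
  obtain D where D: "\<And>s. s \<in> {0..1} \<Longrightarrow> (\<gamma> has_vector_derivative D s) (at s)"
    and cD: "continuous_on {0..1} D"
    using assms(1) unfolding C1_differentiable_on_def by blast
  have c\<gamma>: "continuous_on {0..1} \<gamma>"
    by (rule continuous_at_imp_continuous_on) (use D has_vector_derivative_continuous in blast)
  define n where "n s = norm (DR_mc br (\<gamma> s) (D s))" for s
  have cn: "continuous_on {0..1} n"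
    unfolding n_def by (intro continuous_on_norm continuous_on_mc c\<gamma> cD)
  \<comment> \<open>Since 2 cosh^2(r/2) - 1 = cosh r, this is cosh r along the curve, shifted by
    \<open>\<delta>\<close>.\<close>
  define m where "m \<delta> s = 2 * dist_w x0 (\<gamma> s) - 1 + \<delta>" for \<delta> s
  have le: "arcosh (m \<delta> 1) - arcosh (m \<delta> 0) \<le> DR_len br \<gamma>" if \<delta>: "\<delta> > 0" for \<delta>
  proof -
    define E where "E s = 1 / sqrt ((m \<delta> s)\<^sup>2 - 1) * (2 * dist_w' x0 (\<gamma> s) (D s))" for s
    have m1: "m \<delta> s > 1" for s using dist_w_ge_1[of x0 "\<gamma> s"] \<delta> by (simp add: m_def)
    have dm: "(m \<delta> has_real_derivative 2 * dist_w' x0 (\<gamma> s) (D s)) (at s)" if "s \<in> {0..1}" for s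
    proof -
      have "((\<lambda>s. dist_w x0 (\<gamma> s)) has_derivative (\<lambda>h. dist_w' x0 (\<gamma> s) (h *\<^sub>R D s))) (at s)"
        using D[OF that] dist_w_has_derivative unfolding has_vector_derivative_def
        by (rule has_derivative_compose)
      moreover have "(\<lambda>h. dist_w' x0 (\<gamma> s) (h *\<^sub>R D s)) = (*) (dist_w' x0 (\<gamma> s) (D s))"
        using linear_scale[OF has_derivative_linear[OF dist_w_has_derivative[of x0 "\<gamma> s"]]] by auto
      ultimately have "((\<lambda>s. dist_w x0 (\<gamma> s)) has_real_derivative dist_w' x0 (\<gamma> s) (D s)) (at s)"
        by (simp add: has_field_derivative_def)
      then show ?thesis unfolding m_def by (auto intro!: derivative_eq_intros)
    qed
    have "(E has_integral (arcosh (m \<delta> 1) - arcosh (m \<delta> 0))) {0..1}"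
    proof (rule fundamental_theorem_of_calculus)
      fix s :: real assume s: "s \<in> {0..1}"
      have "((\<lambda>s. arcosh (m \<delta> s)) has_real_derivative E s) (at s)"
        unfolding E_def by (rule DERIV_chain2[OF arcosh_real_has_field_derivative[OF m1] dm[OF s]])
      then show "((\<lambda>s. arcosh (m \<delta> s)) has_vector_derivative E s) (at s within {0..1})"
        using has_real_derivative_iff_has_vector_derivative has_vector_derivative_at_within by blast
    qed simp
    moreover have "(n has_integral integral {0..1} n) {0..1}"
      using integrable_continuous_interval[OF cn] by (rule integrable_integral)
    ultimately have "arcosh (m \<delta> 1) - arcosh (m \<delta> 0) \<le> integral {0..1} n"
    proof (rule has_integral_le)
      fix s :: real assume "s \<in> {0..1}"
      have "2 * dist_w' x0 (\<gamma> s) (D s) \<le> 2 * sqrt ((dist_w x0 (\<gamma> s))\<^sup>2 - dist_w x0 (\<gamma> s)) * n s"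
        using abs_dist_w'_le[of x0 "\<gamma> s" "D s"] by (simp add: n_def)
      also have "2 * sqrt ((dist_w x0 (\<gamma> s))\<^sup>2 - dist_w x0 (\<gamma> s)) = sqrt ((2 * dist_w x0 (\<gamma> s) - 1)\<^sup>2 - 1)"
        by (rule real_sqrt_unique[symmetric])
          (use dist_w_ge_1[of x0 "\<gamma> s"] in \<open>auto simp: power_mult_distrib power2_eq_square algebra_simps\<close>)
      \<comment> \<open>The shift only enlarges the denominator of \<open>E\<close>, so the bound by
        the speed of the curve survives.\<close>
      also have "sqrt ((2 * dist_w x0 (\<gamma> s) - 1)\<^sup>2 - 1) * n s \<le> sqrt ((m \<delta> s)\<^sup>2 - 1) * n s"
        using \<delta> dist_w_ge_1[of x0 "\<gamma> s"] by (intro mult_right_mono real_sqrt_le_mono diff_right_mono power_mono) (auto simp: m_def n_def)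
      finally have "2 * dist_w' x0 (\<gamma> s) (D s) \<le> sqrt ((m \<delta> s)\<^sup>2 - 1) * n s" .
      moreover have "sqrt ((m \<delta> s)\<^sup>2 - 1) > 0"
        using m1[of s] by (simp add: one_less_power)
      ultimately show "E s \<le> n s"
        by (simp add: E_def field_simps)
    qed
    moreover have "DR_len br \<gamma> = integral {0..1} n"
      unfolding n_def[abs_def] by (rule DR_len_eq) (rule D)
    ultimately show ?thesis by simp
  qed
  have "((\<lambda>\<delta>. arcosh (m \<delta> 1) - arcosh (m \<delta> 0)) \<longlongrightarrow> arcosh (m 0 1) - arcosh (m 0 0)) (at_right 0)"
  proof -
    have "((\<lambda>\<delta>. arcosh (m \<delta> s)) \<longlongrightarrow> arcosh (m 0 s)) (at_right 0)" for s
    proof (rule tendsto_arcosh_strong)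
      have "((\<lambda>\<delta>. m \<delta> s) \<longlongrightarrow> 2 * dist_w x0 (\<gamma> s) - 1 + 0) (at_right 0)"
        unfolding m_def by (intro tendsto_intros)
      then show "((\<lambda>\<delta>. m \<delta> s) \<longlongrightarrow> m 0 s) (at_right 0)" by (simp add: m_def)
      show "m 0 s \<ge> 1" using dist_w_ge_1[of x0 "\<gamma> s"] by (simp add: m_def)
      show "\<forall>\<^sub>F \<delta> in at_right 0. m \<delta> s \<ge> 1"
        using dist_w_ge_1[of x0 "\<gamma> s"] by (auto simp: m_def eventually_at_filter intro!: always_eventually)
    qed
    then show ?thesis by (intro tendsto_diff)
  qed
  then have "arcosh (m 0 1) - arcosh (m 0 0) \<le> DR_len br \<gamma>"
    by (rule tendsto_upperbound) (use le in \<open>auto simp: eventually_at_filter intro!: always_eventually\<close>)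
  moreover have "dist_w x0 x0 = 1" by (simp add: dist_w_eq_1_iff)
  ultimately show ?thesis using assms by (simp add: m_def)
qed

text \<open>The curve below is the image of a radius of the unit ball under the Cayley transform;
  \<open>S\<close>, \<open>Z\<close>, \<open>V\<close> are the ball coordinates of its end point.\<close>
lemma radial_curve_speed:
  fixes V :: 'v and Z :: 'z and S :: real
  defines "B \<equiv> Z \<bullet> Z" and "C \<equiv> V \<bullet> V"
  defines "K \<equiv> \<lambda>l. (1 - l * S)\<^sup>2 + l\<^sup>2 * B" and "N \<equiv> \<lambda>l. 1 - l\<^sup>2 * (S\<^sup>2 + B + C)"
  defines "\<gamma> \<equiv> \<lambda>l. ((2 * l * (1 - l * S) / K l) *\<^sub>R V + (2 * l\<^sup>2 / K l) *\<^sub>R DR_J br Z V,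
      (2 * l / K l) *\<^sub>R Z, ln (N l / K l))"
  defines "D \<equiv> \<lambda>l. ((2 * ((1 - l * S)\<^sup>2 - l\<^sup>2 * B) / (K l)\<^sup>2) *\<^sub>R V + (4 * l * (1 - l * S) / (K l)\<^sup>2) *\<^sub>R DR_J br Z V,
      (2 * (1 - l\<^sup>2 * (S\<^sup>2 + B)) / (K l)\<^sup>2) *\<^sub>R Z,
      - 2 * l * (S\<^sup>2 + B + C) / N l - (- 2 * S * (1 - l * S) + 2 * l * B) / K l)"
  assumes N: "N l > 0" and K: "K l > 0"
  shows "(\<gamma> has_vector_derivative D l) (at l)"
    and "norm (DR_mc br (\<gamma> l) (D l)) = 2 * sqrt (S\<^sup>2 + B + C) / N l"
proof -
  have dK: "(K has_real_derivative (- 2 * S * (1 - l * S) + 2 * l * B)) (at l)"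
    unfolding K_def by (auto intro!: derivative_eq_intros)
  have dN: "(N has_real_derivative (- 2 * l * (S\<^sup>2 + B + C))) (at l)"
    unfolding N_def by (auto intro!: derivative_eq_intros)
  have Kl: "K l = (1 - l * S)\<^sup>2 + l\<^sup>2 * B" by (simp add: K_def)
  have quot: "((\<lambda>l. f l / K l) has_real_derivative p / (K l)\<^sup>2) (at l)"
    if "(f has_real_derivative e) (at l)" "e * K l - f l * (- 2 * S * (1 - l * S) + 2 * l * B) = p" for f p e
    using DERIV_divide[OF that(1) dK] K unfolding that(2) by (simp add: power2_eq_square)
  have 1: "((\<lambda>l. 2 * l * (1 - l * S) / K l) has_real_derivative 2 * ((1 - l * S)\<^sup>2 - l\<^sup>2 * B) / (K l)\<^sup>2) (at l)"
    by (rule quot[where e = "2 * (1 - 2 * l * S)"])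
      (auto intro!: derivative_eq_intros simp: Kl power2_eq_square algebra_simps)
  have 2: "((\<lambda>l. 2 * l\<^sup>2 / K l) has_real_derivative 4 * l * (1 - l * S) / (K l)\<^sup>2) (at l)"
    by (rule quot[where e = "4 * l"])
      (auto intro!: derivative_eq_intros simp: Kl power2_eq_square algebra_simps)
  have 3: "((\<lambda>l. 2 * l / K l) has_real_derivative 2 * (1 - l\<^sup>2 * (S\<^sup>2 + B)) / (K l)\<^sup>2) (at l)"
    by (rule quot[where e = 2])
      (auto intro!: derivative_eq_intros simp: Kl power2_eq_square algebra_simps)
  have 4: "((\<lambda>l. ln (N l / K l)) has_real_derivative
      - 2 * l * (S\<^sup>2 + B + C) / N l - (- 2 * S * (1 - l * S) + 2 * l * B) / K l) (at l)"
  proof -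
    have id: "inverse (a / k) * ((b * k - a * c) / (k * k)) = b / a - c / k"
      if "a > 0" "k > 0" for a b c k :: real
      using that by (simp add: field_simps)
    show ?thesis
      unfolding id[OF N K, symmetric]
      by (rule DERIV_chain2[OF DERIV_ln DERIV_divide[OF dN dK]]) (use N K in auto)
  qed
  show "(\<gamma> has_vector_derivative D l) (at l)"
    unfolding \<gamma>_def D_def
    by (intro has_vector_derivative_Pair has_vector_derivative_add
        has_vector_derivative_scaleR[where g' = 0, simplified] has_vector_derivative_const 1 2 3
        4[unfolded has_real_derivative_iff_has_vector_derivative])
  show "norm (DR_mc br (\<gamma> l) (D l)) = 2 * sqrt (S\<^sup>2 + B + C) / N l"
  proof -
    define T E where "T = S\<^sup>2 + B + C" and "E = 1 - l * S"
    define \<alpha> \<beta> \<alpha>' \<beta>' \<zeta> \<tau> where "\<alpha> = 2 * l * E / K l" and "\<beta> = 2 * l\<^sup>2 / K l"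
      and "\<alpha>' = 2 * (E\<^sup>2 - l\<^sup>2 * B) / (K l)\<^sup>2" and "\<beta>' = 4 * l * E / (K l)\<^sup>2"
      and "\<zeta> = 2 * (1 - l\<^sup>2 * (S\<^sup>2 + B)) / (K l)\<^sup>2"
      and "\<tau> = - 2 * l * T / N l - (- 2 * S * E + 2 * l * B) / K l"
    note Kl = Kl[folded E_def]
    have Nl: "N l = 1 - l\<^sup>2 * T" by (simp add: N_def T_def)
    have D: "D l = (\<alpha>' *\<^sub>R V + \<beta>' *\<^sub>R DR_J br Z V, \<zeta> *\<^sub>R Z, \<tau>)"
      by (simp add: D_def \<alpha>'_def \<beta>'_def \<zeta>_def \<tau>_def E_def T_def)
    have \<gamma>: "fst (\<gamma> l) = \<alpha> *\<^sub>R V + \<beta> *\<^sub>R DR_J br Z V" "snd (snd (\<gamma> l)) = ln (N l / K l)"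
      by (simp_all add: \<gamma>_def \<alpha>_def \<beta>_def E_def)
    have e: "(exp (- ln (N l / K l) / 2))\<^sup>2 = K l / N l" "exp (- ln (N l / K l)) = K l / N l"
      unfolding exp_half(1)[of "- ln (N l / K l)", symmetric] using N K by (simp_all add: exp_minus)
    \<comment> \<open>Treating J_Z as an imaginary number of modulus |Z|, the v-part of the curve is
      2l (1 - lS - l J_Z)^(-1) V, because (E - l J_Z)(E + l J_Z) = K. Its derivative is 2 (1 - lS -
      l J_Z)^(-2) V, of squared norm 4C / K^2.\<close>
    have "\<alpha>'\<^sup>2 + \<beta>'\<^sup>2 * B = ((2 * (E\<^sup>2 - l\<^sup>2 * B))\<^sup>2 + (4 * l * E)\<^sup>2 * B) / ((K l)\<^sup>2 * (K l)\<^sup>2)"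
      unfolding \<alpha>'_def \<beta>'_def power_divide power2_eq_square[of "(K l)\<^sup>2"] add_divide_distrib by simp
    also have "(2 * (E\<^sup>2 - l\<^sup>2 * B))\<^sup>2 + (4 * l * E)\<^sup>2 * B = 4 * (K l)\<^sup>2"
      unfolding Kl by algebra
    finally have ab: "\<alpha>'\<^sup>2 + \<beta>'\<^sup>2 * B = 4 / (K l)\<^sup>2"
      using K mult_divide_mult_cancel_right[of "(K l)\<^sup>2" 4 "(K l)\<^sup>2"] by (simp add: power2_eq_square)
    \<comment> \<open>The bracket of the v-part with its own derivative is this Wronskian times C Z,
      as V and J_Z V bracket trivially with themselves.\<close>
    have "\<alpha> * \<beta>' - \<alpha>' * \<beta> = (8 * l\<^sup>2 * E\<^sup>2 - 4 * l\<^sup>2 * (E\<^sup>2 - l\<^sup>2 * B)) / ((K l)\<^sup>2 * K l)"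
      using K by (simp add: \<alpha>_def \<beta>_def \<alpha>'_def \<beta>'_def field_simps power2_eq_square)
    also have "8 * l\<^sup>2 * E\<^sup>2 - 4 * l\<^sup>2 * (E\<^sup>2 - l\<^sup>2 * B) = 4 * l\<^sup>2 * K l"
      by (simp add: Kl algebra_simps power2_eq_square)
    finally have w: "\<alpha> * \<beta>' - \<alpha>' * \<beta> = 4 * l\<^sup>2 / (K l)\<^sup>2" using K by simp
    have n1: "(\<alpha>' *\<^sub>R V + \<beta>' *\<^sub>R DR_J br Z V) \<bullet> (\<alpha>' *\<^sub>R V + \<beta>' *\<^sub>R DR_J br Z V) = 4 * C / (K l)\<^sup>2"
    proof -
      have "(\<alpha>' *\<^sub>R V + \<beta>' *\<^sub>R DR_J br Z V) \<bullet> (\<alpha>' *\<^sub>R V + \<beta>' *\<^sub>R DR_J br Z V) = (\<alpha>'\<^sup>2 + \<beta>'\<^sup>2 * B) * C"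
        by (simp add: inner_add_left inner_add_right inner_J_J B_def C_def power2_eq_square algebra_simps)
      then show ?thesis by (simp add: ab)
    qed
    have "br (DR_J br Z V) V = - C *\<^sub>R Z"
      using br_skew[of "DR_J br Z V" V] by (simp add: br_J C_def)
    then have "br (fst (\<gamma> l)) (\<alpha>' *\<^sub>R V + \<beta>' *\<^sub>R DR_J br Z V) = ((\<alpha> * \<beta>' - \<alpha>' * \<beta>) * C) *\<^sub>R Z"
      unfolding \<gamma> by (simp add: br_simps br_J C_def algebra_simps)
    then have "\<zeta> *\<^sub>R Z - (1/2) *\<^sub>R br (fst (\<gamma> l)) (\<alpha>' *\<^sub>R V + \<beta>' *\<^sub>R DR_J br Z V)
        = (\<zeta> - 2 * l\<^sup>2 * C / (K l)\<^sup>2) *\<^sub>R Z"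
      by (simp add: w scaleR_diff_left)
    also have "\<zeta> - 2 * l\<^sup>2 * C / (K l)\<^sup>2 = 2 * N l / (K l)\<^sup>2"
      by (simp add: \<zeta>_def Nl T_def algebra_simps flip: diff_divide_distrib)
    finally have mc: "DR_mc br (\<gamma> l) (D l) = (exp (- ln (N l / K l) / 2) *\<^sub>R (\<alpha>' *\<^sub>R V + \<beta>' *\<^sub>R DR_J br Z V),
        (K l / N l * (2 * N l / (K l)\<^sup>2)) *\<^sub>R Z, \<tau>)"
      by (simp add: DR_mc_alt D \<gamma>(2) e(2))
    have "(norm (DR_mc br (\<gamma> l) (D l)))\<^sup>2 = (exp (- ln (N l / K l) / 2))\<^sup>2 * (4 * C / (K l)\<^sup>2)
        + (K l / N l * (2 * N l / (K l)\<^sup>2))\<^sup>2 * B + \<tau>\<^sup>2"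
      unfolding mc power2_norm_eq_inner inner_Pair inner_scaleR_left inner_scaleR_right n1 B_def inner_real_def
      by (simp only: power2_eq_square mult.assoc add.assoc)
    also have "\<dots> = 4 * C / (K l * N l) + 4 * B / (K l)\<^sup>2 + \<tau>\<^sup>2"
      unfolding e using N K by (simp add: field_simps power2_eq_square)
    also have "\<dots> = 4 * T / (N l)\<^sup>2"
    proof -
      \<comment> \<open>\<open>X\<close> is the numerator of - \<open>\<tau>\<close> over the common
        denominator \<open>K l * N l\<close>; after that the claim is a polynomial identity.\<close>
      define X where "X = 2 * l * T * K l + (- 2 * S * E + 2 * l * B) * N l"
      have "\<tau> = - X / (K l * N l)"
        using N K by (simp add: X_def \<tau>_def field_simps)
      then have \<tau>: "\<tau>\<^sup>2 = X\<^sup>2 / ((K l)\<^sup>2 * (N l)\<^sup>2)"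
        by (simp add: power_divide power_mult_distrib)
      have "4 * C * K l * N l + 4 * B * (N l)\<^sup>2 + X\<^sup>2 = 4 * T * (K l)\<^sup>2"
        unfolding X_def Kl Nl T_def E_def by algebra
      then have "(4 * C * K l * N l + 4 * B * (N l)\<^sup>2 + X\<^sup>2) / ((K l)\<^sup>2 * (N l)\<^sup>2)
          = 4 * T * (K l)\<^sup>2 / ((K l)\<^sup>2 * (N l)\<^sup>2)" by simp
      then show ?thesis
        unfolding \<tau> using N K by (simp add: add_divide_distrib) (simp add: power2_eq_square)
    qed
    finally have "norm (DR_mc br (\<gamma> l) (D l)) = sqrt (4 * T / (N l)\<^sup>2)"
      by (metis norm_ge_zero real_sqrt_unique)
    then show ?thesis
      using N by (simp add: real_sqrt_divide real_sqrt_mult flip: T_def)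
  qed
qed

text \<open>The point x0^(-1) x is pulled back to the unit ball. In the ball the metric speed along
  a radius of length t is 2t / (1 - l^2 t^2), which integrates to 2 artanh t, and this equals arcosh
  (2w - 1).\<close>

lemma exists_curve_DR_len:
  "\<exists>\<gamma>. \<gamma> C1_differentiable_on {0..1} \<and> \<gamma> 0 = x0 \<and> \<gamma> 1 = x \<and> DR_len br \<gamma> = arcosh (2 * dist_w x0 x - 1)"
proof -
  define y where "y = DR_mc br x0 (x - x0)"
  define u b a where "u = DR_u y" and "b = fst (snd y) \<bullet> fst (snd y)" and "a = exp (snd (snd y))"
  define d where "d = u\<^sup>2 + b"
  \<comment> \<open>Inverse Cayley transform of \<open>y\<close>: formally S + Z = 1 - 2 (u +
    Z_y)^(-1) and V = (u + J)^(-1) V_y, where J belongs to the z-part Z_y of \<open>y\<close>. The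
    inverse of u + J is (u - J) / d because J^2 = - b.\<close>
  define S where "S = 1 - 2 * u / d"
  define Z where "Z = (2 / d) *\<^sub>R fst (snd y)"
  define V where "V = (1 / d) *\<^sub>R (u *\<^sub>R fst y - DR_J br (fst (snd y)) (fst y))"
  define T where "T = S\<^sup>2 + Z \<bullet> Z + V \<bullet> V"
  define K where "K l = (1 - l * S)\<^sup>2 + l\<^sup>2 * (Z \<bullet> Z)" for l
  define N where "N l = 1 - l\<^sup>2 * T" for l
  have a: "a > 0" by (simp add: a_def)
  have u: "u = 1 + a + fst y \<bullet> fst y / 4" by (simp add: u_def DR_u_def a_def)
  have "u > 0" using a unfolding u by (intro add_pos_nonneg) auto
  then have d: "d > 0" unfolding d_def b_def by (intro add_pos_nonneg) auto
  have w: "dist_w x0 x = d / (4 * a)"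
    by (simp add: dist_w_def DR_w_def d_def u_def b_def a_def flip: y_def)
  have ZZ: "Z \<bullet> Z = 4 * b / d\<^sup>2" by (simp add: Z_def b_def power2_eq_square)
  have "(u *\<^sub>R fst y - DR_J br (fst (snd y)) (fst y)) \<bullet> (u *\<^sub>R fst y - DR_J br (fst (snd y)) (fst y))
      = d * (fst y \<bullet> fst y)"
    by (simp add: inner_diff_left inner_diff_right inner_J_J d_def b_def power2_eq_square algebra_simps)
  then have VV: "V \<bullet> V = (fst y \<bullet> fst y) / d"
    using d by (simp add: V_def)
  \<comment> \<open>As w = d / (4a), this says T = 1 - 1/w = tanh^2(r/2): the ball point has
    Euclidean norm tanh(r/2), below 1.\<close>
  have T: "T = 1 - 4 * a / d"
  proof -
    have "T * d\<^sup>2 = (d - 2 * u)\<^sup>2 + 4 * b + (4 * u - 4 * a - 4) * d"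
      using d unfolding T_def ZZ VV S_def u by (simp add: field_simps power2_eq_square)
    also have "\<dots> = (1 - 4 * a / d) * d\<^sup>2"
      using d by (simp add: d_def field_simps power2_eq_square)
    finally show ?thesis using d by simp
  qed
  have T01: "T \<ge> 0" "T < 1"
    using a d by (simp add: T_def) (simp add: T a d)
  define t where "t = sqrt T"
  have t: "t\<^sup>2 = T" "0 \<le> t" "t < 1" using T01 by (simp_all add: t_def)
  have lt: "l * t < 1" if "l \<in> {0..1}" for l
    using that t mult_left_le_one_le[of t l] by simp
  have N: "N l > 0" if "l \<in> {0..1}" for l
  proof -
    have "(l * t)\<^sup>2 < 1"
      using lt[OF that] that t by (simp add: power_less_one_iff abs_square_less_1)
    then show ?thesis by (simp add: N_def power_mult_distrib t)
  qed
  have K: "K l > 0" if "l \<in> {0..1}" for l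
  proof -
    have "S \<le> \<bar>S\<bar>" "\<bar>S\<bar> \<le> t"
      unfolding t_def T_def by (simp_all add: real_le_rsqrt)
    then have "l * S \<le> l * t" using that by (intro mult_left_mono) auto
    then have "(1 - l * S)\<^sup>2 > 0" using lt[OF that] by simp
    then show ?thesis unfolding K_def by (intro add_pos_nonneg) auto
  qed
  define \<gamma>0 where "\<gamma>0 l = ((2 * l * (1 - l * S) / K l) *\<^sub>R V + (2 * l\<^sup>2 / K l) *\<^sub>R DR_J br Z V,
      (2 * l / K l) *\<^sub>R Z, ln (N l / K l))" for l
  define D0 where "D0 l = ((2 * ((1 - l * S)\<^sup>2 - l\<^sup>2 * (Z \<bullet> Z)) / (K l)\<^sup>2) *\<^sub>R V + (4 * l * (1 - l * S) / (K l)\<^sup>2) *\<^sub>R DR_J br Z V,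
      (2 * (1 - l\<^sup>2 * (S\<^sup>2 + Z \<bullet> Z)) / (K l)\<^sup>2) *\<^sub>R Z,
      - 2 * l * T / N l - (- 2 * S * (1 - l * S) + 2 * l * (Z \<bullet> Z)) / K l)" for l
  note speed = radial_curve_speed[where V = V and Z = Z and S = S, folded T_def K_def N_def,
      folded \<gamma>0_def D0_def]
  \<comment> \<open>The left translate of \<open>\<gamma>0\<close> by \<open>x0\<close> in the
    group, hence a curve of the same length starting at \<open>x0\<close>.\<close>
  define \<gamma> where "\<gamma> l = x0 + DR_frame br x0 (\<gamma>0 l)" for l
  define D where "D l = DR_frame br x0 (D0 l)" for l
  have bl: "bounded_linear (DR_frame br x0)" using linear_frame linear_conv_bounded_linear by blast
  have deriv: "(\<gamma> has_vector_derivative D l) (at l)" if "l \<in> {0..1}" for l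
    unfolding \<gamma>_def D_def
    using bounded_linear.has_vector_derivative[OF bl speed(1)[OF N[OF that] K[OF that]]]
    by (intro has_vector_derivative_add[where f' = 0, simplified]) auto
  have "continuous_on {0..1} D0"
  proof -
    have "continuous_on {0..1} K" "continuous_on {0..1} N"
      unfolding K_def[abs_def] N_def[abs_def] by (intro continuous_intros)+
    moreover have "\<forall>l\<in>{0..1}. K l \<noteq> 0" "\<forall>l\<in>{0..1}. (K l)\<^sup>2 \<noteq> 0" "\<forall>l\<in>{0..1}. N l \<noteq> 0"
      using K N by (simp_all add: less_imp_neq[symmetric])
    ultimately show ?thesis
      unfolding D0_def[abs_def] by (intro continuous_intros)
  qed
  then have cD: "continuous_on {0..1} D"
    unfolding D_def by (intro continuous_on_frame continuous_on_const)
  have \<gamma>1: "\<gamma>0 1 = y"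
  proof -
    have K1: "K 1 = 4 / d"
    proof -
      have "K 1 * d\<^sup>2 = 4 * d"
        using d unfolding K_def ZZ S_def by (simp add: field_simps power2_eq_square) (simp add: d_def power2_eq_square algebra_simps)
      then show ?thesis using d by (simp add: field_simps power2_eq_square)
    qed
    have N1: "N 1 = 4 * a / d" by (simp add: N_def T)
    have "(2 * 1 * (1 - 1 * S) / K 1) *\<^sub>R V + (2 * 1\<^sup>2 / K 1) *\<^sub>R DR_J br Z V = u *\<^sub>R V + DR_J br (fst (snd y)) V"
      using d by (simp add: K1 S_def Z_def J_simps)
    also have "\<dots> = (1 / d) *\<^sub>R (u\<^sup>2 + b) *\<^sub>R fst y"
      by (simp add: V_def J_simps J_J b_def power2_eq_square algebra_simps)
    finally have "(2 * 1 * (1 - 1 * S) / K 1) *\<^sub>R V + (2 * 1\<^sup>2 / K 1) *\<^sub>R DR_J br Z V = fst y"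
      using d by (simp flip: d_def)
    moreover have "(2 * 1 / K 1) *\<^sub>R Z = fst (snd y)" using d by (simp add: K1 Z_def)
    moreover have "ln (N 1 / K 1) = snd (snd y)" using d by (simp add: K1 N1 a_def)
    ultimately show ?thesis by (simp add: \<gamma>0_def prod_eq_iff)
  qed
  have "DR_len br \<gamma> = integral {0..1} (\<lambda>l. norm (DR_mc br (\<gamma> l) (D l)))"
    by (rule DR_len_eq) (rule deriv)
  also have "\<dots> = integral {0..1} (\<lambda>l. 2 * t / N l)"
  proof (rule integral_cong)
    fix l :: real assume l: "l \<in> {0..1}"
    have "DR_mc br (\<gamma> l) (D l) = DR_mc br (DR_mc br x0 (\<gamma> l - x0)) (DR_mc br x0 (D l))"
      by (rule mc_left_invariant[symmetric])
    also have "\<dots> = DR_mc br (\<gamma>0 l) (D0 l)" by (simp add: \<gamma>_def D_def)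
    finally show "norm (DR_mc br (\<gamma> l) (D l)) = 2 * t / N l"
      using speed(2)[OF N[OF l] K[OF l]] by (simp add: t_def)
  qed
  \<comment> \<open>The antiderivative is 2 artanh (l t). The factors \<open>1 * t\<close> and
    \<open>0 * t\<close> keep its end values in the shape required by
    \<open>fundamental_theorem_of_calculus\<close>.\<close>
  also have "((\<lambda>l. 2 * t / N l) has_integral (ln ((1 + 1 * t) / (1 - 1 * t)) - ln ((1 + 0 * t) / (1 - 0 * t)))) {0..1}"
  proof (rule fundamental_theorem_of_calculus)
    fix l :: real assume l: "l \<in> {0..1}"
    have pos: "1 - l * t > 0" "1 + l * t > 0" using lt[OF l] l t by (auto intro: add_pos_nonneg)
    have "((\<lambda>l. (1 + l * t) / (1 - l * t)) has_real_derivative 2 * t / (1 - l * t)\<^sup>2) (at l)"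
      using pos by (auto intro!: derivative_eq_intros simp: field_simps power2_eq_square)
    then have "((\<lambda>l. ln ((1 + l * t) / (1 - l * t))) has_real_derivative
        inverse ((1 + l * t) / (1 - l * t)) * (2 * t / (1 - l * t)\<^sup>2)) (at l)"
      using pos by (intro DERIV_chain2[OF DERIV_ln]) auto
    moreover have "N l = (1 - l * t) * (1 + l * t)"
      by (simp add: N_def t(1)[symmetric] power2_eq_square algebra_simps)
    then have "inverse ((1 + l * t) / (1 - l * t)) * (2 * t / (1 - l * t)\<^sup>2) = 2 * t / N l"
      using pos by (simp add: power2_eq_square)
    ultimately show "((\<lambda>l. ln ((1 + l * t) / (1 - l * t))) has_vector_derivative 2 * t / N l) (at l within {0..1})"
      using has_real_derivative_iff_has_vector_derivative has_vector_derivative_at_within by metis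
  qed simp
  then have "integral {0..1} (\<lambda>l. 2 * t / N l) = ln ((1 + t) / (1 - t))"
    by (auto dest: integral_unique)
  also have "\<dots> = arcosh (2 * dist_w x0 x - 1)"
  proof -
    have "dist_w x0 x = 1 / (1 - t\<^sup>2)" using a d by (simp add: w t T)
    then have dist_w: "2 * dist_w x0 x - 1 = (1 + t\<^sup>2) / (1 - t\<^sup>2)"
      using T01 t by (simp add: field_simps)
    have "((1 + T) / (1 - T))\<^sup>2 - 1 = 4 * T / (1 - T)\<^sup>2"
    proof -
      have "((1 + T) / (1 - T))\<^sup>2 - 1 = ((1 + T)\<^sup>2 - (1 - T)\<^sup>2) / (1 - T)\<^sup>2"
        using T01 by (simp add: power_divide diff_divide_distrib)
      also have "(1 + T)\<^sup>2 - (1 - T)\<^sup>2 = 4 * T" by algebra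
      finally show ?thesis .
    qed
    then have "((1 + t\<^sup>2) / (1 - t\<^sup>2))\<^sup>2 - 1 = (2 * t / (1 - t\<^sup>2))\<^sup>2"
      by (simp add: t(1) power_divide power_mult_distrib)
    then have "sqrt (((1 + t\<^sup>2) / (1 - t\<^sup>2))\<^sup>2 - 1) = 2 * t / (1 - t\<^sup>2)"
      using T01 t by simp
    moreover have "(1 + t\<^sup>2) / (1 - t\<^sup>2) + 2 * t / (1 - t\<^sup>2) = (1 + t) / (1 - t)"
    proof -
      have "1 - t\<^sup>2 = (1 - t) * (1 + t)" "1 + t\<^sup>2 + 2 * t = (1 + t) * (1 + t)" by algebra+
      then show ?thesis using t by (simp flip: add_divide_distrib)
    qed
    ultimately show ?thesis
      using dist_w_ge_1[of x0 x] dist_w by (simp add: arcosh_real_def)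
  qed
  finally have "DR_len br \<gamma> = arcosh (2 * dist_w x0 x - 1)" .
  moreover have "\<gamma> C1_differentiable_on {0..1}"
    unfolding C1_differentiable_on_def using deriv cD by blast
  moreover have "\<gamma> 0 = x0"
    using linear_0[OF linear_frame] by (simp add: \<gamma>_def \<gamma>0_def N_def K_def flip: zero_prod_def)
  moreover have "\<gamma> 1 = x" by (simp add: \<gamma>_def \<gamma>1 y_def)
  ultimately show ?thesis by blast
qed

theorem DR_dist_eq: "DR_dist br x0 x = arcosh (2 * dist_w x0 x - 1)"
  unfolding DR_dist_def
proof (rule cInf_eq_minimum)
  show "arcosh (2 * dist_w x0 x - 1) \<in> {DR_len br \<gamma> | \<gamma>. \<gamma> C1_differentiable_on {0..1} \<and> \<gamma> 0 = x0 \<and> \<gamma> 1 = x}"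
    using exists_curve_DR_len[of x0 x] by force
  fix r
  assume "r \<in> {DR_len br \<gamma> | \<gamma>. \<gamma> C1_differentiable_on {0..1} \<and> \<gamma> 0 = x0 \<and> \<gamma> 1 = x}"
  then show "arcosh (2 * dist_w x0 x - 1) \<le> r"
    using arcosh_dist_w_le_DR_len by blast
qed

end

section \<open>The weak form of the Laplacian\<close>

lemma linear_euclidean_inner:
  fixes l :: "'a::euclidean_space \<Rightarrow> real"
  assumes "linear l"
  shows "l v = (\<Sum>b\<in>Basis. l b *\<^sub>R b) \<bullet> v"
proof -
  have "l v = l (\<Sum>b\<in>Basis. (v \<bullet> b) *\<^sub>R b)" by (simp add: euclidean_representation)
  also have "\<dots> = (\<Sum>b\<in>Basis. (v \<bullet> b) * l b)"
    using assms by (simp add: linear_sum linear_scale)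
  finally show ?thesis by (simp add: inner_sum_left inner_commute[of v] mult.commute)
qed

lemma cosh_half_div_sinh_half:
  fixes r :: real
  shows "cosh (r / 2) / sinh (r / 2) = (cosh r + 1) / sinh r"
proof -
  have "cosh r + 1 = 2 * (cosh (r / 2))\<^sup>2" "sinh r = 2 * sinh (r / 2) * cosh (r / 2)"
    using cosh_double_cosh[of "r / 2"] sinh_double[of "r / 2"] by simp_all
  then show ?thesis by (simp add: power2_eq_square)
qed

lemma continuous_on_DR_u: "continuous_on S DR_u"
  by (rule continuous_at_imp_continuous_on) (rule ballI, rule has_derivative_continuous[OF DR_u_has_derivative])

lemma continuous_on_DR_w: "continuous_on S DR_w"
  by (rule continuous_at_imp_continuous_on) (rule ballI, rule has_derivative_continuous[OF DR_w_has_derivative])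

lemma continuous_on_DR_w': "continuous_on UNIV (\<lambda>x. DR_w' x d)"
  unfolding DR_w'_def by (intro continuous_intros continuous_on_DR_u continuous_on_DR_w) auto

lemma sets_DR_vol [simp, measurable_cong]: "sets DR_vol = sets borel" and space_DR_vol [simp]: "space DR_vol = UNIV"
  by (simp_all add: DR_vol_def)

lemma measurable_DR_weight [measurable]:
  "(\<lambda>x::'a::euclidean_space \<times> 'b::euclidean_space \<times> real. exp (c * snd (snd x))) \<in> borel_measurable borel"
  by (intro borel_measurable_continuous_onI continuous_intros)

lemma integrable_DR_vol_iff:
  fixes f :: "'v::euclidean_space \<times> 'z::euclidean_space \<times> real \<Rightarrow> real"
  assumes "f \<in> borel_measurable borel"
  shows "integrable DR_vol f \<longleftrightarrow>
    integrable lborel (\<lambda>x. exp (- (real DIM('v) / 2 + real DIM('z)) * snd (snd x)) * f x)"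
  unfolding DR_vol_def using assms measurable_DR_weight
  by (subst integrable_real_density) auto

lemma integral_DR_vol:
  fixes f :: "'v::euclidean_space \<times> 'z::euclidean_space \<times> real \<Rightarrow> real"
  assumes "f \<in> borel_measurable borel"
  shows "integral\<^sup>L DR_vol f =
    integral\<^sup>L lborel (\<lambda>x. exp (- (real DIM('v) / 2 + real DIM('z)) * snd (snd x)) * f x)"
  unfolding DR_vol_def using assms measurable_DR_weight
  by (subst integral_real_density) auto

lemma integrable_DR_vol_continuous:
  fixes f :: "'v::euclidean_space \<times> 'z::euclidean_space \<times> real \<Rightarrow> real"
  assumes f: "continuous_on UNIV f" and K: "compact K" and zero: "\<And>x. x \<notin> K \<Longrightarrow> f x = 0"
  shows "integrable DR_vol f"
proof -
  let ?g = "\<lambda>x. exp (- (real DIM('v) / 2 + real DIM('z)) * snd (snd x)) * f x"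
  have "integrable lborel (\<lambda>x. indicator K x *\<^sub>R ?g x)"
    by (rule borel_integrable_compact[OF K]) (intro continuous_intros continuous_on_subset[OF f] subset_UNIV)
  moreover have "(\<lambda>x. indicator K x *\<^sub>R ?g x) = ?g"
    using zero by (force simp: indicator_def)
  ultimately show ?thesis
    using f by (simp add: integrable_DR_vol_iff borel_measurable_continuous_onI)
qed

lemma AE_DR_vol_neq: "AE x in DR_vol. x \<noteq> (x0 :: 'v::euclidean_space \<times> 'z::euclidean_space \<times> real)"
  unfolding DR_vol_def
  by (subst AE_density) (use AE_lborel_singleton[of x0] measurable_DR_weight in auto)

context H_type
begin

text \<open>In the orthonormal frame the supremum is a dual norm, attained at the frame image of
  \<open>sgn g\<close>; for g = 0 that vector is 0 and still attains it. The formula gives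
  continuity in x, which the supremum does not show.\<close>

lemma DR_grad_norm_eq:
  assumes "(\<phi> has_derivative l) (at x)"
  shows "DR_grad_norm br \<phi> x = norm (\<Sum>b\<in>Basis. l (DR_frame br x b) *\<^sub>R b)"
proof -
  define g where "g = (\<Sum>b\<in>Basis. l (DR_frame br x b) *\<^sub>R b)"
  have l: "linear l" using assms by (rule has_derivative_linear)
  have lg: "l u = g \<bullet> DR_mc br x u" for u
    using linear_euclidean_inner[OF linear_compose[OF linear_frame l], of x "DR_mc br x u"]
    by (simp add: g_def)
  have "Sup {l u | u. norm (DR_mc br x u) \<le> 1} = norm g"
  proof (rule cSup_eq_maximum)
    have "l (DR_frame br x (sgn g)) = norm g"
      by (simp add: lg sgn_div_norm power2_norm_eq_inner[symmetric] power2_eq_square)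
        (metis left_inverse norm_eq_zero)
    moreover have "norm (DR_mc br x (DR_frame br x (sgn g))) \<le> 1" by (simp add: norm_sgn)
    ultimately show "norm g \<in> {l u | u. norm (DR_mc br x u) \<le> 1}" by (metis (mono_tags, lifting) mem_Collect_eq)
    show "t \<le> norm g" if t0: "t \<in> {l u | u. norm (DR_mc br x u) \<le> 1}" for t
    proof -
      obtain u where "t = l u" and u: "norm (DR_mc br x u) \<le> 1" using t0 by blast
      then have t: "t = g \<bullet> DR_mc br x u" by (simp add: lg)
      have "t \<le> norm g * norm (DR_mc br x u)" unfolding t by (rule norm_cauchy_schwarz)
      also have "\<dots> \<le> norm g" using u by (simp add: mult_left_le)
      finally show ?thesis .
    qed
  qed
  moreover have "frechet_derivative \<phi> (at x) = l"
    using frechet_derivative_at[OF assms] by simp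
  ultimately show ?thesis by (simp add: DR_grad_norm_def g_def)
qed

lemma abs_derivative_le_grad_norm:
  assumes "(\<phi> has_derivative l) (at x)"
  shows "\<bar>l u\<bar> \<le> DR_grad_norm br \<phi> x * norm (DR_mc br x u)"
proof -
  have "linear l" using assms by (rule has_derivative_linear)
  then have "l u = (\<Sum>b\<in>Basis. l (DR_frame br x b) *\<^sub>R b) \<bullet> DR_mc br x u"
    using linear_euclidean_inner[OF linear_compose[OF linear_frame, of l], of x "DR_mc br x u"] by simp
  then show ?thesis
    unfolding DR_grad_norm_eq[OF assms] by (simp add: Cauchy_Schwarz_ineq2)
qed

lemma continuous_on_derivative_apply:
  fixes \<phi>' :: "'v \<times> 'z \<times> real \<Rightarrow> 'v \<times> 'z \<times> real \<Rightarrow> real"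
  assumes "\<And>x. linear (\<phi>' x)" "\<And>b. continuous_on UNIV (\<lambda>x. \<phi>' x b)" "continuous_on UNIV f"
  shows "continuous_on UNIV (\<lambda>x. \<phi>' x (f x))"
proof -
  have "\<phi>' x (f x) = (\<Sum>b\<in>Basis. \<phi>' x b *\<^sub>R b) \<bullet> f x" for x
    using assms(1) by (rule linear_euclidean_inner)
  then show ?thesis by (simp only:) (intro continuous_intros assms)
qed

lemma continuous_on_grad_norm:
  assumes \<phi>: "\<And>x. (\<phi> has_derivative \<phi>' x) (at x)" and \<phi>': "\<And>b. continuous_on UNIV (\<lambda>x. \<phi>' x b)"
  shows "continuous_on UNIV (DR_grad_norm br \<phi>)"
proof -
  have "DR_grad_norm br \<phi> = (\<lambda>x. norm (\<Sum>b\<in>Basis. \<phi>' x (DR_frame br x b) *\<^sub>R b))"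
    using DR_grad_norm_eq[OF \<phi>] by auto
  then show ?thesis
    by (simp only:) (intro continuous_intros continuous_on_frame
      continuous_on_derivative_apply[where \<phi>' = \<phi>', OF has_derivative_linear[OF \<phi>] \<phi>'])
qed

definition dist_grad :: "'v \<times> 'z \<times> real \<Rightarrow> 'v \<times> 'z \<times> real \<Rightarrow> 'v \<times> 'z \<times> real" where
  "dist_grad x0 x = DR_frame br x0 (DR_grad_w br (DR_mc br x0 (x - x0)))"

definition dist_grad' :: "'v \<times> 'z \<times> real \<Rightarrow> 'v \<times> 'z \<times> real \<Rightarrow> 'v \<times> 'z \<times> real \<Rightarrow> 'v \<times> 'z \<times> real" where
  "dist_grad' x0 x d = DR_frame br x0 (DR_grad_w' br (DR_mc br x0 (x - x0)) (DR_mc br x0 d))"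

lemma dist_grad_has_derivative: "(dist_grad x0 has_derivative dist_grad' x0 x) (at x)"
proof -
  have "bounded_linear (DR_frame br x0)" using linear_frame linear_conv_bounded_linear by blast
  then show ?thesis
    unfolding dist_grad_def[abs_def] dist_grad'_def[abs_def]
    by (rule bounded_linear.has_derivative)
      (rule has_derivative_compose[OF mc_diff_has_derivative DR_grad_w_has_derivative])
qed

lemma dist_w'_dist_grad: "dist_w' x0 x (dist_grad x0 x) = (dist_w x0 x)\<^sup>2 - dist_w x0 x"
  by (simp add: dist_w'_def dist_grad_def dist_w_def DR_w'_grad)

lemma norm_mc_dist_grad: "norm (DR_mc br x (dist_grad x0 x)) = sqrt ((dist_w x0 x)\<^sup>2 - dist_w x0 x)"
proof -
  have "DR_mc br x (dist_grad x0 x) = DR_mc br (DR_mc br x0 (x - x0)) (DR_mc br x0 (dist_grad x0 x))"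
    by (rule mc_left_invariant[symmetric])
  also have "\<dots> = DR_mc br (DR_mc br x0 (x - x0)) (DR_grad_w br (DR_mc br x0 (x - x0)))"
    by (simp add: dist_grad_def)
  finally show ?thesis
    using norm_mc_grad[of "DR_mc br x0 (x - x0)"] by (metis dist_w_def norm_ge_zero real_sqrt_unique)
qed

text \<open>Moving the base point conjugates the derivative by \<open>DR_frame br x0\<close>, which
  preserves the trace, and leaves the t-component unchanged; so the Laplacian at the identity
  carries over.\<close>

lemma trace_dist_grad':
  "(\<Sum>b\<in>Basis. dist_grad' x0 x b \<bullet> b) - (real DIM('v) / 2 + real DIM('z)) * snd (snd (dist_grad x0 x))
    = (1 + real DIM('v) / 2 + real DIM('z)) * dist_w x0 x - (real DIM('z) + 1) / 2"
proof -
  have "(\<Sum>b\<in>Basis. dist_grad' x0 x b \<bullet> b) = (\<Sum>b\<in>Basis. DR_grad_w' br (DR_mc br x0 (x - x0)) b \<bullet> b)"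
    unfolding dist_grad'_def
    by (rule trace_conjugate[OF linear_frame linear_mc has_derivative_linear[OF DR_grad_w_has_derivative]]) simp
  moreover have "snd (snd (dist_grad x0 x)) = DR_u (DR_mc br x0 (x - x0)) / 2 - dist_w x0 x"
    by (simp add: dist_grad_def DR_frame_def DR_grad_w_def dist_w_def)
  ultimately show ?thesis
    using trace_DR_grad_w'[of "DR_mc br x0 (x - x0)"] by (simp add: dist_w_def)
qed

lemma continuous_on_dist_w: "continuous_on S (dist_w x0)"
  by (rule continuous_at_imp_continuous_on) (rule ballI, rule has_derivative_continuous[OF dist_w_has_derivative])

lemma continuous_on_dist_grad: "continuous_on S (dist_grad x0)"
  by (rule continuous_at_imp_continuous_on) (rule ballI, rule has_derivative_continuous[OF dist_grad_has_derivative])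

lemma continuous_on_mc_diff: "continuous_on S (\<lambda>x. DR_mc br x0 (x - x0))"
  by (intro continuous_on_mc continuous_intros)

lemma continuous_on_dist_w': "continuous_on UNIV (\<lambda>x. dist_w' x0 x d)"
  unfolding dist_w'_def
  by (rule continuous_on_compose2[OF continuous_on_DR_w' continuous_on_mc_diff]) simp

lemma continuous_on_DR_grad_w': "continuous_on UNIV (\<lambda>x. DR_grad_w' br x d)"
proof -
  interpret J: bounded_bilinear "DR_J br" using bilinear_J by (simp add: bilinear_conv_bounded_bilinear)
  show ?thesis
    unfolding DR_grad_w'_def
    by (intro continuous_intros continuous_on_DR_u continuous_on_DR_w' J.continuous_on) auto
qed

lemma continuous_on_dist_grad': "continuous_on UNIV (\<lambda>x. dist_grad' x0 x d)"
  unfolding dist_grad'_def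
  by (intro continuous_on_frame continuous_on_const
    continuous_on_compose2[OF continuous_on_DR_grad_w' continuous_on_mc_diff]) simp

text \<open>The weak form of \<open>\<Delta> dist_w = (1 + h) dist_w - (q + 1) / 2\<close>, tested against \<open>k(dist_w) \<psi>\<close>.\<close>
lemma integral_radial_divergence:
  fixes k k' :: "real \<Rightarrow> real" and \<psi>' :: "'v \<times> 'z \<times> real \<Rightarrow> 'v \<times> 'z \<times> real \<Rightarrow> real" and \<psi> :: "'v \<times> 'z \<times> real \<Rightarrow> real" and x0 :: "'v \<times> 'z \<times> real"
  defines "h \<equiv> real DIM('v) / 2 + real DIM('z)"
  defines "B \<equiv> \<lambda>x. \<psi> x * (k' (dist_w x0 x) * ((dist_w x0 x)\<^sup>2 - dist_w x0 x)
      + k (dist_w x0 x) * ((1 + h) * dist_w x0 x - (real DIM('z) + 1) / 2)) + k (dist_w x0 x) * \<psi>' x (dist_grad x0 x)"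
  assumes k: "\<And>w. (k has_real_derivative k' w) (at w)" and k': "continuous_on UNIV k'"
    and \<psi>: "\<And>x. (\<psi> has_derivative \<psi>' x) (at x)" and \<psi>': "\<And>b. continuous_on UNIV (\<lambda>x. \<psi>' x b)"
    and K: "compact K" and zero: "\<And>x. x \<notin> K \<Longrightarrow> \<psi> x = 0"
  shows "integrable DR_vol B" "integral\<^sup>L DR_vol B = 0"
proof -
  define e where "e x = exp (- h * snd (snd x))" for x :: "'v \<times> 'z \<times> real"
  define \<kappa> where "\<kappa> x = e x * k (dist_w x0 x) * \<psi> x" for x
  define \<kappa>' where "\<kappa>' x d = e x * (\<psi> x * (k' (dist_w x0 x) * dist_w' x0 x d) + k (dist_w x0 x) * \<psi>' x d)
      - h * snd (snd d) * \<kappa> x" for x d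
  have de: "(e has_derivative (\<lambda>d. - h * snd (snd d) * e x)) (at x)" for x
    unfolding e_def by (auto intro!: derivative_eq_intros)
  have dk: "((\<lambda>x. k (dist_w x0 x)) has_derivative (\<lambda>d. k' (dist_w x0 x) * dist_w' x0 x d)) (at x)" for x
    using has_derivative_compose[OF dist_w_has_derivative k[unfolded has_field_derivative_def]] .
  have d\<kappa>: "(\<kappa> has_derivative \<kappa>' x) (at x)" for x
    unfolding \<kappa>_def \<kappa>'_def[abs_def]
    by (rule has_derivative_eq_rhs[OF has_derivative_mult[OF has_derivative_mult[OF de dk] \<psi>]])
      (simp add: fun_eq_iff \<kappa>_def algebra_simps)
  have ck: "continuous_on UNIV (\<lambda>x. k (dist_w x0 x))"
    by (rule continuous_at_imp_continuous_on) (rule ballI, rule has_derivative_continuous[OF dk])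
  have ck': "continuous_on UNIV (\<lambda>x. k' (dist_w x0 x))"
    by (rule continuous_on_compose2[OF k' continuous_on_dist_w]) simp
  have c\<psi>: "continuous_on UNIV \<psi>"
    by (rule continuous_at_imp_continuous_on) (rule ballI, rule has_derivative_continuous[OF \<psi>])
  have ce: "continuous_on UNIV e" unfolding e_def by (intro continuous_intros)
  have c\<kappa>': "continuous_on UNIV (\<lambda>x. \<kappa>' x d)" for d
    unfolding \<kappa>'_def \<kappa>_def by (intro continuous_intros ce c\<psi> ck ck' continuous_on_dist_w' \<psi>')
  have "continuous_on UNIV B"
    unfolding B_def
    by (intro continuous_intros c\<psi> ck ck' continuous_on_dist_w continuous_on_dist_grad
        continuous_on_derivative_apply[where \<phi>' = \<psi>', OF has_derivative_linear[OF \<psi>] \<psi>'])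
  then have mB: "B \<in> borel_measurable borel" by (rule borel_measurable_continuous_onI)
  have eq: "\<kappa>' x (dist_grad x0 x) + \<kappa> x * (\<Sum>b\<in>Basis. dist_grad' x0 x b \<bullet> b) = e x * B x" for x
  proof -
    \<comment> \<open>The summand with h times the t-component cancels against the derivative of the
      volume density \<open>e\<close> inside \<open>\<kappa>'\<close>.\<close>
    have "(\<Sum>b\<in>Basis. dist_grad' x0 x b \<bullet> b) = h * snd (snd (dist_grad x0 x)) + ((1 + h) * dist_w x0 x - (real DIM('z) + 1) / 2)"
      using trace_dist_grad'[of x0 x] unfolding h_def add.assoc[symmetric] by linarith
    note tr = this
    show ?thesis
      unfolding tr \<kappa>'_def \<kappa>_def B_def dist_w'_dist_grad by algebra
  qed
  have "\<kappa> x = 0" if "x \<notin> K" for x using zero[OF that] by (simp add: \<kappa>_def)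
  note div = integral_divergence[OF dist_grad_has_derivative continuous_on_dist_grad' d\<kappa> c\<kappa>' K this, of x0, unfolded eq]
  show "integrable DR_vol B" "integral\<^sup>L DR_vol B = 0"
    using div by (simp_all add: integrable_DR_vol_iff[OF mB] integral_DR_vol[OF mB] e_def h_def)
qed

end

section \<open>The weighted Hardy inequality\<close>

lemma has_real_derivative_pos_part_square:
  "((\<lambda>y::real. (max 0 y)\<^sup>2) has_real_derivative 2 * max 0 y) (at y)"
proof (cases y "0::real" rule: linorder_cases)
  case less
  have "((\<lambda>y::real. 0) has_real_derivative 0) (at y)" by simp
  then have "((\<lambda>y::real. (max 0 y)\<^sup>2) has_real_derivative 0) (at y)"
    by (rule has_field_derivative_transform_within_open[of _ _ _ "{..<0}"]) (use less in auto)
  then show ?thesis using less by simp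
next
  case greater
  have "((\<lambda>y::real. y\<^sup>2) has_real_derivative 2 * y) (at y)" by (auto intro!: derivative_eq_intros)
  then have "((\<lambda>y::real. (max 0 y)\<^sup>2) has_real_derivative 2 * y) (at y)"
    by (rule has_field_derivative_transform_within_open[of _ _ _ "{0<..}"]) (use greater in auto)
  then show ?thesis using greater by simp
next
  case equal
  have "((\<lambda>d::real. (max 0 d)\<^sup>2 / d) \<longlongrightarrow> 0) (at 0)"
  proof (rule Lim_transform_eventually)
    show "((\<lambda>d::real. max 0 d) \<longlongrightarrow> 0) (at 0)"
      using tendsto_max[OF tendsto_const[of "0::real"] tendsto_ident_at[of "0::real" UNIV]] by simp
    show "\<forall>\<^sub>F d::real in at 0. max 0 d = (max 0 d)\<^sup>2 / d"
      by (rule always_eventually) (auto simp: max_def power2_eq_square)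
  qed
  then show ?thesis using equal by (simp add: has_field_derivative_iff)
qed

text \<open>The square makes the positive part continuously differentiable at the threshold w = 1 +
  \<epsilon>. For w > 1 the function is nondecreasing in w and tends to 1 as \<epsilon> decreases to
  0.\<close>

definition cutoff :: "real \<Rightarrow> real \<Rightarrow> real" where
  "cutoff \<epsilon> w = (max 0 (1 - \<epsilon> / (w - 1)))\<^sup>2"

lemma cutoff_le_1: "cutoff \<epsilon> w \<le> 1" if "\<epsilon> > 0" "w > 1"
  using that by (auto simp: cutoff_def power_le_one_iff)

lemma cutoff_nonneg: "cutoff \<epsilon> w \<ge> 0"
  by (simp add: cutoff_def)

definition cutoff' :: "real \<Rightarrow> real \<Rightarrow> real" where
  "cutoff' \<epsilon> w = 2 * max 0 (1 - \<epsilon> / (w - 1)) * (\<epsilon> / (w - 1)\<^sup>2)"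

lemma cutoff_has_derivative:
  "(cutoff \<epsilon> has_real_derivative cutoff' \<epsilon> w) (at w)" if "w > 1"
  unfolding cutoff_def[abs_def] cutoff'_def
proof (rule DERIV_chain2[OF has_real_derivative_pos_part_square])
  show "((\<lambda>w. 1 - \<epsilon> / (w - 1)) has_real_derivative \<epsilon> / (w - 1)\<^sup>2) (at w)"
    using that by (auto intro!: derivative_eq_intros simp: power2_eq_square)
qed

lemma cutoff_tendsto: "((\<lambda>n. cutoff (inverse (real (Suc n))) w) \<longlonglongrightarrow> 1)" if "w > 1"
proof -
  have "(\<lambda>n. (max 0 (1 - inverse (real (Suc n)) / (w - 1)))\<^sup>2) \<longlonglongrightarrow> (max 0 (1 - 0 / (w - 1)))\<^sup>2"
    using that by (intro tendsto_intros tendsto_max LIMSEQ_inverse_real_of_nat) auto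
  then show ?thesis by (simp add: cutoff_def)
qed

lemma cutoff_eq_0: "cutoff \<epsilon> w = 0" "cutoff' \<epsilon> w = 0" if "w > 1" "w \<le> 1 + \<epsilon>"
  using that by (auto simp: cutoff_def cutoff'_def max_def field_simps)

text \<open>In the variable \<open>w = cosh\<^sup>2 (r / 2)\<close> the radial field \<open>F(r) \<nabla>r\<close> is \<open>radial F (w) \<nabla>w\<close>.\<close>
definition radial :: "(real \<Rightarrow> real) \<Rightarrow> real \<Rightarrow> real" where
  "radial F w = F (arcosh (2 * w - 1)) / sqrt (w\<^sup>2 - w)"

definition radial' :: "(real \<Rightarrow> real) \<Rightarrow> (real \<Rightarrow> real) \<Rightarrow> real \<Rightarrow> real" where
  "radial' F F' w = (F' (arcosh (2 * w - 1)) - F (arcosh (2 * w - 1)) * (2 * w - 1) / (2 * sqrt (w\<^sup>2 - w))) / (w\<^sup>2 - w)"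

lemma square_minus_pos: "w\<^sup>2 - w > 0" if "w > 1" for w :: real
proof -
  have "w * (w - 1) > 0" using that by simp
  then show ?thesis by (simp add: power2_eq_square algebra_simps)
qed

lemma arcosh_double_has_derivative:
  "((\<lambda>w. arcosh (2 * w - 1)) has_real_derivative 1 / sqrt (w\<^sup>2 - w)) (at w)" if "w > 1" for w :: real
proof -
  have "((\<lambda>w. arcosh (2 * w - 1)) has_real_derivative 1 / sqrt ((2 * w - 1)\<^sup>2 - 1) * 2) (at w)"
    by (rule DERIV_chain2[OF arcosh_real_has_field_derivative])
      (use that in \<open>auto intro!: derivative_eq_intros\<close>)
  also have "(2 * w - 1)\<^sup>2 - 1 = 4 * (w\<^sup>2 - w)" by algebra
  finally show ?thesis by (simp add: real_sqrt_mult del: right_diff_distrib_numeral)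
qed

lemma radial_has_derivative:
  assumes F: "\<And>r. r > 0 \<Longrightarrow> (F has_real_derivative F' r) (at r)" and w: "w > 1"
  shows "(radial F has_real_derivative radial' F F' w) (at w)"
proof -
  note pos = square_minus_pos[OF w]
  have r: "arcosh (2 * w - 1) > 0" using w by simp
  have 1: "((\<lambda>w. F (arcosh (2 * w - 1))) has_real_derivative F' (arcosh (2 * w - 1)) * (1 / sqrt (w\<^sup>2 - w))) (at w)"
    by (rule DERIV_chain2[OF F[OF r] arcosh_double_has_derivative[OF w]])
  have 2: "((\<lambda>w. sqrt (w\<^sup>2 - w)) has_real_derivative (2 * w - 1) / (2 * sqrt (w\<^sup>2 - w))) (at w)"
    using pos by (auto intro!: derivative_eq_intros simp: field_simps)
  have "(a * (1 / s) * s - f * ((2 * w - 1) / (2 * s))) / (s * s) = (a - f * (2 * w - 1) / (2 * s)) / t"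
    if "s * s = t" "s > 0" for a f s t :: real
    using that by simp
  from this[of "sqrt (w\<^sup>2 - w)" "w\<^sup>2 - w"] show ?thesis
    unfolding radial_def[abs_def] radial'_def
    using DERIV_divide[OF 1 2] pos by simp
qed

lemma continuous_on_radial':
  assumes "continuous_on {0<..} F" "continuous_on {0<..} F'"
  shows "continuous_on {1<..} (radial' F F')"
proof -
  have r: "continuous_on {1<..} (\<lambda>w::real. arcosh (2 * w - 1))"
    by (intro continuous_intros) auto
  have "continuous_on {1<..} (\<lambda>w. F (arcosh (2 * w - 1)))" "continuous_on {1<..} (\<lambda>w. F' (arcosh (2 * w - 1)))"
    by (rule continuous_on_compose2[OF assms(1) r], force) (rule continuous_on_compose2[OF assms(2) r], force)
  moreover have "\<forall>w\<in>{1<..}. w\<^sup>2 - w \<noteq> (0::real)" "\<forall>w\<in>{1<..}. 2 * sqrt (w\<^sup>2 - w) \<noteq> (0::real)"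
    using square_minus_pos by (auto simp: less_imp_neq[symmetric])
  ultimately show ?thesis
    unfolding radial'_def by (intro continuous_intros)
qed

text \<open>The two formulas agree on the overlap of w > 1 and w < 1 + \<epsilon>, where the cutoff
  vanishes, and these open sets cover the line. So the singular profile becomes a function
  differentiable on all reals, as the divergence theorem for w demands.\<close>

lemma cut_radial_has_derivative:
  assumes F: "\<And>r. r > 0 \<Longrightarrow> (F has_real_derivative F' r) (at r)" and \<epsilon>: "\<epsilon> > 0"
  shows "((\<lambda>w. if w > 1 then cutoff \<epsilon> w * radial F w else 0) has_real_derivative
    (if w > 1 then cutoff' \<epsilon> w * radial F w + cutoff \<epsilon> w * radial' F F' w else 0)) (at w)"
proof (cases "w > 1")
  case True
  have "((\<lambda>w. cutoff \<epsilon> w * radial F w) has_real_derivative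
      cutoff' \<epsilon> w * radial F w + cutoff \<epsilon> w * radial' F F' w) (at w)"
    using DERIV_mult[OF cutoff_has_derivative[OF True] radial_has_derivative[OF F True], of \<epsilon>]
    by (simp add: mult.commute)
  then have "((\<lambda>w. if w > 1 then cutoff \<epsilon> w * radial F w else 0) has_real_derivative
      cutoff' \<epsilon> w * radial F w + cutoff \<epsilon> w * radial' F F' w) (at w)"
    by (rule has_field_derivative_transform_within_open[of _ _ _ "{1<..}"]) (use True in auto)
  then show ?thesis using True by simp
next
  case False
  have "((\<lambda>w. 0) has_real_derivative 0) (at w)" by simp
  then have "((\<lambda>w. if w > 1 then cutoff \<epsilon> w * radial F w else 0) has_real_derivative 0) (at w)"
    by (rule has_field_derivative_transform_within_open[of _ _ _ "{..<1 + \<epsilon>}"])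
      (use False \<epsilon> cutoff_eq_0 in auto)
  then show ?thesis using False by simp
qed

lemma continuous_on_cut_radial':
  assumes F: "continuous_on {0<..} F" and F': "continuous_on {0<..} F'" and \<epsilon>: "\<epsilon> > 0"
  shows "continuous_on UNIV
    (\<lambda>w. if w > 1 then cutoff' \<epsilon> w * radial F w + cutoff \<epsilon> w * radial' F F' w else 0)"
proof -
  have r: "continuous_on {1<..} (\<lambda>w. F (arcosh (2 * w - 1)))"
    by (rule continuous_on_compose2[OF F]) (auto intro!: continuous_intros)
  have nz: "\<forall>w\<in>{1<..}. sqrt (w\<^sup>2 - w) \<noteq> (0::real)" "\<forall>w\<in>{1<..}. (w - 1)\<^sup>2 \<noteq> (0::real)"
     "\<forall>w\<in>{1<..}. w - 1 \<noteq> (0::real)"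
    using square_minus_pos by (auto simp: less_imp_neq[symmetric])
  have "continuous_on {1<..} (radial F)"
    unfolding radial_def[abs_def] by (intro continuous_intros r nz)
  then have "continuous_on {1<..} (\<lambda>w. cutoff' \<epsilon> w * radial F w + cutoff \<epsilon> w * radial' F F' w)"
    unfolding cutoff_def cutoff'_def
    by (intro continuous_intros continuous_on_max continuous_on_radial' F F' nz)
  then have "continuous_on {1<..} (\<lambda>w. if w > 1 then cutoff' \<epsilon> w * radial F w + cutoff \<epsilon> w * radial' F F' w else 0)"
    by (rule continuous_on_eq) auto
  moreover have "continuous_on {..<1 + \<epsilon>} (\<lambda>w. if w > 1 then cutoff' \<epsilon> w * radial F w + cutoff \<epsilon> w * radial' F F' w else 0)"
    by (rule continuous_on_eq[OF continuous_on_const[of _ 0]]) (auto simp: cutoff_eq_0)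
  ultimately have "continuous_on ({1<..} \<union> {..<1 + \<epsilon>}) (\<lambda>w. if w > 1 then cutoff' \<epsilon> w * radial F w + cutoff \<epsilon> w * radial' F F' w else 0)"
    by (rule continuous_on_open_Un[rotated 2]) auto
  moreover have "{1<..} \<union> {..<1 + \<epsilon>} = (UNIV :: real set)" using \<epsilon> by auto
  ultimately show ?thesis by simp
qed

text \<open>Smoothness is encoded by differentiability of all iterated derivatives; the list
  \<open>[b]\<close> makes the first derivative along b differentiable, hence continuous.\<close>

lemma smooth_fun_C1:
  assumes "smooth_fun \<phi>"
  shows "(\<phi> has_derivative frechet_derivative \<phi> (at x)) (at x)"
    and "continuous_on UNIV (\<lambda>x. frechet_derivative \<phi> (at x) b)"
proof -
  have d: "iter_dd us \<phi> differentiable (at x)" for us x using assms by (auto simp: smooth_fun_def)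
  show "(\<phi> has_derivative frechet_derivative \<phi> (at x)) (at x)"
    using d[of "[]" x] by (simp add: frechet_derivative_works)
  show "continuous_on UNIV (\<lambda>x. frechet_derivative \<phi> (at x) b)"
    using d[of "[b]"] by (intro continuous_at_imp_continuous_on ballI differentiable_imp_continuous_within) simp
qed

context H_type
begin

lemma measurable_DR_dist: "(\<lambda>x. DR_dist br x0 x) \<in> borel_measurable borel"
proof -
  have "continuous_on UNIV (\<lambda>x. 2 * dist_w x0 x - 1)" by (intro continuous_intros continuous_on_dist_w)
  then have "continuous_on UNIV (\<lambda>x. arcosh (2 * dist_w x0 x - 1))"
    by (rule continuous_on_compose2[OF continuous_on_arcosh[OF order.refl]])
      (use dist_w_ge_1[of x0] in \<open>force simp: algebra_simps\<close>)
  then show ?thesis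
    unfolding DR_dist_eq by (rule borel_measurable_continuous_onI)
qed

text \<open>Test against \<open>\<eta> F \<nabla>r\<close> with a cutoff \<open>\<eta>\<close> vanishing near \<open>x0\<close>: as \<open>F \<ge> 0\<close> and \<open>\<eta>\<close> is
  nondecreasing in \<open>r\<close>, the term with \<open>\<eta>'\<close> has the right sign, so Fatou's lemma removes the cutoff and
  no integrability of \<open>V\<close> near \<open>x0\<close> is required.\<close>
lemma powr_hardy:
  fixes \<phi> :: "'v \<times> 'z \<times> real \<Rightarrow> real" and x0 :: "'v \<times> 'z \<times> real"
  defines "h \<equiv> real DIM('v) / 2 + real DIM('z)"
  assumes P: "P > 1"
    and F: "\<And>r. r > 0 \<Longrightarrow> (F has_real_derivative F' r) (at r)" and F': "continuous_on {0<..} F'"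
    and F0: "\<And>r. r > 0 \<Longrightarrow> F r \<ge> 0"
    and V: "V \<in> borel_measurable borel" "\<And>r. r > 0 \<Longrightarrow> V r \<ge> 0"
    and VF: "\<And>r. r > 0 \<Longrightarrow> V r = F' r + F r * (h * (cosh (r / 2) / sinh (r / 2)) - real DIM('z) / sinh r)
        - (P - 1) * F r powr (P / (P - 1))"
    and \<phi>: "smooth_fun \<phi>" "compact_support \<phi>"
  shows "integrable DR_vol (\<lambda>x. DR_grad_norm br \<phi> x powr P)"
    and "(\<integral>\<^sup>+x. ennreal (V (DR_dist br x0 x) * \<bar>\<phi> x\<bar> powr P) \<partial>DR_vol)
      \<le> ennreal (integral\<^sup>L DR_vol (\<lambda>x. DR_grad_norm br \<phi> x powr P))"
proof -
  define \<phi>' where "\<phi>' x = frechet_derivative \<phi> (at x)" for x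
  have d\<phi>: "(\<phi> has_derivative \<phi>' x) (at x)" and c\<phi>': "continuous_on UNIV (\<lambda>x. \<phi>' x b)" for x b
    unfolding \<phi>'_def using smooth_fun_C1[OF \<phi>(1)] by auto
  have c\<phi>: "continuous_on UNIV \<phi>"
    by (rule continuous_at_imp_continuous_on) (rule ballI, rule has_derivative_continuous[OF d\<phi>])
  define K where "K = closure {x. \<phi> x \<noteq> 0}"
  have K: "compact K" using \<phi>(2) by (simp add: compact_support_def K_def)
  have \<phi>0: "\<phi> x = 0" if "x \<notin> K" for x
    using that closure_subset[of "{x. \<phi> x \<noteq> 0}"] by (auto simp: K_def)
  have \<phi>'0: "\<phi>' x = (\<lambda>_. 0)" if "x \<notin> K" for x
    using has_derivative_eq_0_outside[OF d\<phi> compact_imp_closed[OF K] \<phi>0 that] .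
  define gn where "gn x = DR_grad_norm br \<phi> x" for x
  have cgn: "continuous_on UNIV gn"
    unfolding gn_def using continuous_on_grad_norm[OF d\<phi> c\<phi>'] by (simp add: eta_contract_eq)
  have gn_nn: "gn x \<ge> 0" for x
    unfolding gn_def DR_grad_norm_eq[OF d\<phi>] by simp
  have igrad: "integrable DR_vol (\<lambda>x. gn x powr P)"
  proof (rule integrable_DR_vol_continuous[OF _ K])
    show "continuous_on UNIV (\<lambda>x. gn x powr P)"
      using P gn_nn by (intro continuous_on_powr' cgn continuous_on_const) auto
    show "gn x powr P = 0" if "x \<notin> K" for x
      unfolding gn_def DR_grad_norm_eq[OF d\<phi>] \<phi>'0[OF that] by simp
  qed
  then show "integrable DR_vol (\<lambda>x. DR_grad_norm br \<phi> x powr P)" by (simp add: gn_def)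
  define \<psi> where "\<psi> x = \<bar>\<phi> x\<bar> powr P" for x
  define \<psi>' where "\<psi>' x d = P * (\<bar>\<phi> x\<bar> powr (P - 1) * sgn (\<phi> x)) * \<phi>' x d" for x d
  have d\<psi>: "(\<psi> has_derivative \<psi>' x) (at x)" for x
    using has_derivative_compose[OF d\<phi> has_real_derivative_abs_powr[OF P, unfolded has_field_derivative_def]]
    unfolding \<psi>_def[abs_def] \<psi>'_def[abs_def] by (simp add: mult.assoc)
  have c\<psi>': "continuous_on UNIV (\<lambda>x. \<psi>' x b)" for b
    unfolding \<psi>'_def
    by (intro continuous_intros c\<phi>' continuous_on_compose2[OF continuous_on_abs_powr_sgn c\<phi>]) (use P in auto)
  have \<psi>0: "\<psi> x = 0" if "x \<notin> K" for x using \<phi>0[OF that] by (simp add: \<psi>_def)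
  have \<psi>_nn: "\<psi> x \<ge> 0" for x by (simp add: \<psi>_def)
  have cF: "continuous_on {0<..} F"
    using F DERIV_isCont by (intro continuous_at_imp_continuous_on) auto
  define r where "r x = DR_dist br x0 x" for x
  have r: "r x = arcosh (2 * dist_w x0 x - 1)" for x by (simp add: r_def DR_dist_eq)
  have W1: "dist_w x0 x > 1 \<longleftrightarrow> x \<noteq> x0" for x using dist_w_ge_1[of x0 x] dist_w_eq_1_iff[of x0 x] by linarith
  have rpos: "r x > 0" if "x \<noteq> x0" for x using that W1[of x] by (simp add: r)
  \<comment> \<open>The indicator removes the null set consisting of \<open>x0\<close>, where r = 0
    and no sign of \<open>V\<close> is known.\<close>
  have step: "(\<integral>\<^sup>+x. ennreal (of_bool (x \<noteq> x0) * cutoff \<epsilon> (dist_w x0 x) * (V (r x) * \<psi> x)) \<partial>DR_vol)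
      \<le> ennreal (integral\<^sup>L DR_vol (\<lambda>x. gn x powr P))" if \<epsilon>: "\<epsilon> > 0" for \<epsilon>
  proof -
    define k where "k w = (if w > 1 then cutoff \<epsilon> w * radial F w else 0)" for w
    define k' where "k' w = (if w > 1 then cutoff' \<epsilon> w * radial F w + cutoff \<epsilon> w * radial' F F' w else 0)" for w
    have dk: "(k has_real_derivative k' w) (at w)" for w
      unfolding k_def[abs_def] k'_def using cut_radial_has_derivative[OF F \<epsilon>] .
    have ck': "continuous_on UNIV k'"
      unfolding k'_def[abs_def] by (rule continuous_on_cut_radial'[OF cF F' \<epsilon>])
    define B where "B x = \<psi> x * (k' (dist_w x0 x) * ((dist_w x0 x)\<^sup>2 - dist_w x0 x)
      + k (dist_w x0 x) * ((1 + h) * dist_w x0 x - (real DIM('z) + 1) / 2)) + k (dist_w x0 x) * \<psi>' x (dist_grad x0 x)" for x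
    note div = integral_radial_divergence[of k k' \<psi> \<psi>' K x0, OF dk ck' d\<psi> c\<psi>' K \<psi>0, folded h_def, folded B_def]
    \<comment> \<open>Everything is pointwise from here: \<open>B\<close> has integral zero, so this
      bound integrates to the claim for fixed \<epsilon>.\<close>
    have pt: "of_bool (x \<noteq> x0) * cutoff \<epsilon> (dist_w x0 x) * (V (r x) * \<psi> x) \<le> B x + gn x powr P" for x
    proof (cases "x = x0")
      case True
      then show ?thesis using W1[of x] by (simp add: B_def k_def k'_def)
    next
      case False
      define w where "w = dist_w x0 x"
      define \<sigma> where "\<sigma> = sqrt (w\<^sup>2 - w)"
      define \<eta> where "\<eta> = cutoff \<epsilon> w"
      define f where "f = F (r x)"
      have w: "w > 1" using False W1 by (simp add: w_def)
      have \<sigma>: "\<sigma> > 0" "\<sigma> * \<sigma> = w\<^sup>2 - w" using square_minus_pos[OF w] by (auto simp: \<sigma>_def)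
      have rw: "r x = arcosh (2 * w - 1)" by (simp add: r w_def)
      have f: "f \<ge> 0" using F0 rpos[OF False] by (simp add: f_def)
      have \<eta>: "0 \<le> \<eta>" "\<eta> \<le> 1" using cutoff_nonneg cutoff_le_1[OF \<epsilon> w] by (auto simp: \<eta>_def)
      have radial: "radial F w = f / \<sigma>" by (simp add: radial_def f_def rw \<sigma>_def)
      have radial': "radial' F F' w * (\<sigma> * \<sigma>) = F' (r x) - f * (2 * w - 1) / (2 * \<sigma>)"
        using \<sigma>(1) unfolding radial'_def \<sigma>(2)[symmetric] by (simp add: f_def rw \<sigma>_def)
      have "sinh (r x) = 2 * \<sigma>"
      proof -
        have "sinh (r x) = sqrt ((2 * w - 1)\<^sup>2 - 1)" unfolding rw using w by (intro sinh_arcosh_real) simp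
        also have "(2 * w - 1)\<^sup>2 - 1 = 2\<^sup>2 * (w\<^sup>2 - w)" by algebra
        finally show ?thesis by (simp only: real_sqrt_mult \<sigma>_def) simp
      qed
      moreover have "cosh (r x) = 2 * w - 1" unfolding rw using w by simp
      ultimately have Sr: "h * (cosh (r x / 2) / sinh (r x / 2)) - real DIM('z) / sinh (r x)
          = (h * w - real DIM('z) / 2) / \<sigma>"
        using \<sigma> by (simp add: cosh_half_div_sinh_half field_simps)
      \<comment> \<open>Differentiating the factor 1 / sqrt (w^2 - w) of the profile lowers the
        coefficient (1 + h) w - (q + 1)/2 by w - 1/2. What is left, (h w - q/2) / \<sigma>, is
        \<Delta>r by \<open>Sr\<close>.\<close>
      have kk: "k' w * (w\<^sup>2 - w) + k w * ((1 + h) * w - (real DIM('z) + 1) / 2)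
          = cutoff' \<epsilon> w * f * \<sigma> + \<eta> * (F' (r x) + f * ((h * w - real DIM('z) / 2) / \<sigma>))"
      proof -
        have "k' w * (w\<^sup>2 - w) = cutoff' \<epsilon> w * (f / \<sigma>) * (\<sigma> * \<sigma>) + \<eta> * (radial' F F' w * (\<sigma> * \<sigma>))"
          using w by (simp add: k'_def radial \<eta>_def \<sigma>(2)[symmetric] algebra_simps)
        also have "\<dots> = cutoff' \<epsilon> w * f * \<sigma> + \<eta> * (F' (r x) - f * (2 * w - 1) / (2 * \<sigma>))"
          unfolding radial' using \<sigma>(1) by simp
        finally show ?thesis
          using w \<sigma>(1) by (simp add: k_def radial \<eta>_def[symmetric] field_simps)
      qed
      have nonneg: "cutoff' \<epsilon> w * f * \<sigma> \<ge> 0"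
        using \<epsilon> f \<sigma> by (auto simp: cutoff'_def intro!: mult_nonneg_nonneg)
      have 1: "\<eta> * (V (r x) + (P - 1) * f powr (P / (P - 1)))
          \<le> k' w * (w\<^sup>2 - w) + k w * ((1 + h) * w - (real DIM('z) + 1) / 2)"
      proof -
        have "V (r x) + (P - 1) * f powr (P / (P - 1)) = F' (r x) + f * ((h * w - real DIM('z) / 2) / \<sigma>)"
          using VF[OF rpos[OF False]] unfolding Sr f_def[symmetric] by linarith
        then show ?thesis using nonneg by (simp add: kk)
      qed
      have 2: "- (k w * \<psi>' x (dist_grad x0 x)) \<le> gn x powr P + \<eta> * ((P - 1) * f powr (P / (P - 1)) * \<psi> x)"
      proof -
        have "\<bar>\<phi>' x (dist_grad x0 x)\<bar> \<le> gn x * \<sigma>"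
          using abs_derivative_le_grad_norm[OF d\<phi>, of x "dist_grad x0 x"] norm_mc_dist_grad[of x x0]
          by (simp add: gn_def \<sigma>_def w_def)
        then have \<psi>'_le: "\<bar>\<psi>' x (dist_grad x0 x)\<bar> \<le> P * \<bar>\<phi> x\<bar> powr (P - 1) * (gn x * \<sigma>)"
          using P by (auto simp: \<psi>'_def abs_mult abs_sgn_eq intro!: mult_left_mono mult_nonneg_nonneg gn_nn \<sigma>(1)[THEN less_imp_le])
        have "\<bar>k w * \<psi>' x (dist_grad x0 x)\<bar> \<le> \<eta> * (f / \<sigma>) * (P * \<bar>\<phi> x\<bar> powr (P - 1) * (gn x * \<sigma>))"
        proof -
          have k: "k w = \<eta> * (f / \<sigma>)" "\<eta> * (f / \<sigma>) \<ge> 0"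
            using w \<eta> f \<sigma> by (auto simp: k_def radial \<eta>_def[symmetric])
          show ?thesis
            unfolding k(1) abs_mult[of "\<eta> * (f / \<sigma>)"] abs_of_nonneg[OF k(2)]
            by (rule mult_left_mono[OF \<psi>'_le k(2)])
        qed
        also have "\<dots> = \<eta> * (P * gn x * (f * \<bar>\<phi> x\<bar> powr (P - 1)))"
          using \<sigma>(1) by simp
        also have "\<dots> \<le> \<eta> * (gn x powr P + (P - 1) * (f * \<bar>\<phi> x\<bar> powr (P - 1)) powr (P / (P - 1)))"
          using \<eta> f by (intro mult_left_mono young_powr P gn_nn) auto
        \<comment> \<open>The exponents multiply to (P - 1) P / (P - 1) = P, which restores
          \<open>\<psi>\<close>.\<close>
        also have "(f * \<bar>\<phi> x\<bar> powr (P - 1)) powr (P / (P - 1)) = f powr (P / (P - 1)) * \<psi> x"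
          using f P by (simp add: powr_mult powr_powr \<psi>_def)
        also have "\<eta> * (gn x powr P + (P - 1) * (f powr (P / (P - 1)) * \<psi> x))
            \<le> gn x powr P + \<eta> * ((P - 1) * f powr (P / (P - 1)) * \<psi> x)"
          using \<eta> mult_left_le_one_le[of "gn x powr P" \<eta>] by (simp add: distrib_left mult.assoc)
        finally show ?thesis by linarith
      qed
      have "\<eta> * (V (r x) * \<psi> x) = \<psi> x * (\<eta> * (V (r x) + (P - 1) * f powr (P / (P - 1))))
          - \<eta> * ((P - 1) * f powr (P / (P - 1)) * \<psi> x)"
        by (simp add: algebra_simps)
      also have "\<dots> \<le> \<psi> x * (k' w * (w\<^sup>2 - w) + k w * ((1 + h) * w - (real DIM('z) + 1) / 2))
          - \<eta> * ((P - 1) * f powr (P / (P - 1)) * \<psi> x)"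
        by (intro diff_right_mono mult_left_mono 1 \<psi>_nn)
      also have "\<dots> \<le> B x + gn x powr P"
        using 2 unfolding B_def w_def[symmetric] by linarith
      finally show ?thesis
        using False by (simp add: \<eta>_def w_def mult.assoc)
    qed
    \<comment> \<open>\<open>B\<close> alone may change sign, but the sum dominates a nonnegative
      function, so its nonnegative integral can be evaluated as a Bochner integral.\<close>
    have nn: "B x + gn x powr P \<ge> 0" for x
    proof -
      have "of_bool (x \<noteq> x0) * cutoff \<epsilon> (dist_w x0 x) * (V (r x) * \<psi> x) \<ge> 0"
        using V(2)[OF rpos] cutoff_nonneg \<psi>_nn by auto
      then show ?thesis using pt[of x] by linarith
    qed
    have "(\<integral>\<^sup>+x. ennreal (of_bool (x \<noteq> x0) * cutoff \<epsilon> (dist_w x0 x) * (V (r x) * \<psi> x)) \<partial>DR_vol)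
        \<le> (\<integral>\<^sup>+x. ennreal (B x + gn x powr P) \<partial>DR_vol)"
      by (intro nn_integral_mono ennreal_leI pt)
    also have "\<dots> = ennreal (integral\<^sup>L DR_vol (\<lambda>x. B x + gn x powr P))"
      using div(1) igrad nn by (intro nn_integral_eq_integral) auto
    also have "integral\<^sup>L DR_vol (\<lambda>x. B x + gn x powr P) = integral\<^sup>L DR_vol (\<lambda>x. gn x powr P)"
      using div igrad by simp
    finally show ?thesis .
  qed
  have mr [measurable]: "r \<in> borel_measurable borel"
    unfolding r_def by (rule measurable_DR_dist)
  have mW [measurable]: "dist_w x0 \<in> borel_measurable borel"
    by (intro borel_measurable_continuous_onI continuous_on_dist_w)
  have m\<psi> [measurable]: "\<psi> \<in> borel_measurable borel"
    by (intro borel_measurable_continuous_onI continuous_at_imp_continuous_on ballI has_derivative_continuous[OF d\<psi>])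
  note [measurable] = V(1)
  define L where "L n x = ennreal (of_bool (x \<noteq> x0) * cutoff (inverse (real (Suc n))) (dist_w x0 x) * (V (r x) * \<psi> x))" for n x
  have mL: "L n \<in> borel_measurable DR_vol" for n
    unfolding L_def cutoff_def by measurable
  have lim: "liminf (\<lambda>n. L n x) = ennreal (V (r x) * \<psi> x)" if "x \<noteq> x0" for x
  proof (rule lim_imp_Liminf)
    have "(\<lambda>n. of_bool (x \<noteq> x0) * cutoff (inverse (real (Suc n))) (dist_w x0 x) * (V (r x) * \<psi> x))
        \<longlonglongrightarrow> of_bool (x \<noteq> x0) * 1 * (V (r x) * \<psi> x)"
      using W1[of x] that by (intro tendsto_intros cutoff_tendsto) auto
    then show "(\<lambda>n. L n x) \<longlonglongrightarrow> ennreal (V (r x) * \<psi> x)"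
      unfolding L_def using that by (intro tendsto_ennrealI) simp
  qed simp
  have "(\<integral>\<^sup>+x. ennreal (V (r x) * \<psi> x) \<partial>DR_vol) = (\<integral>\<^sup>+x. liminf (\<lambda>n. L n x) \<partial>DR_vol)"
    using AE_DR_vol_neq[of x0] by (intro nn_integral_cong_AE) (auto simp: lim)
  also have "\<dots> \<le> liminf (\<lambda>n. \<integral>\<^sup>+x. L n x \<partial>DR_vol)"
    by (rule nn_integral_liminf[OF mL])
  also have "\<dots> \<le> ennreal (integral\<^sup>L DR_vol (\<lambda>x. gn x powr P))"
    unfolding L_def using step by (intro Liminf_le) (auto intro!: always_eventually)
  finally show "(\<integral>\<^sup>+x. ennreal (V (DR_dist br x0 x) * \<bar>\<phi> x\<bar> powr P) \<partial>DR_vol)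
      \<le> ennreal (integral\<^sup>L DR_vol (\<lambda>x. DR_grad_norm br \<phi> x powr P))"
    by (simp add: r_def \<psi>_def gn_def)
qed

end

section \<open>The weight \<open>g\<close> and the theorem\<close>

lemma le_sinh: "x \<le> sinh x" if "x \<ge> 0" for x :: real
proof -
  have "sinh 0 - 0 \<le> sinh x - x"
  proof (rule DERIV_nonneg_imp_nondecreasing[OF that])
    fix t :: real
    show "\<exists>y. ((\<lambda>x. sinh x - x) has_real_derivative y) (at t) \<and> y \<ge> 0"
      by (intro exI[of _ "cosh t - 1"]) (auto intro!: derivative_eq_intros simp: cosh_real_ge_1)
  qed
  then show ?thesis by simp
qed

lemma sinh_le_mult_cosh: "sinh x \<le> x * cosh x" if "x \<ge> 0" for x :: real
proof -
  have "0 * cosh 0 - sinh 0 \<le> x * cosh x - sinh x"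
  proof (rule DERIV_nonneg_imp_nondecreasing[OF that])
    fix t :: real assume "0 \<le> t"
    then show "\<exists>y. ((\<lambda>x. x * cosh x - sinh x) has_real_derivative y) (at t) \<and> y \<ge> 0"
      by (intro exI[of _ "t * sinh t"]) (auto intro!: derivative_eq_intros)
  qed
  then show ?thesis by simp
qed

text \<open>From coth(r/2) >= 2/r and sinh r >= r one gets h g >= (2h - q - 1) / r, and 2h - q = p +
  q.\<close>

lemma DR_g_ge:
  assumes "p \<ge> 0" "q \<ge> 0" "h = (p + 2 * q) / 2" "h > 0" "r > 0"
  shows "DR_g p q r \<ge> (p + q - 1) / (h * r)"
proof -
  have "cosh (r / 2) / sinh (r / 2) \<ge> 2 / r"
    using sinh_le_mult_cosh[of "r / 2"] \<open>r > 0\<close> by (simp add: field_simps)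
  moreover have "q / sinh r \<le> q / r"
    using le_sinh[of r] assms by (intro divide_left_mono) auto
  then have "1 / h * (q / sinh r + 1 / r) \<le> 1 / h * (q / r + 1 / r)"
    using assms by (intro mult_left_mono) auto
  moreover have "2 / r - 1 / h * (q / r + 1 / r) = (p + q - 1) / (h * r)"
  proof -
    have "2 / r - 1 / h * (q / r + 1 / r) = (2 * h - q - 1) / (h * r)"
      using assms(4,5) by (simp add: field_simps)
    also have "2 * h - q - 1 = p + q - 1" unfolding assms(3) by simp
    finally show ?thesis .
  qed
  moreover have g: "DR_g p q r = cosh (r / 2) / sinh (r / 2) - 1 / h * (q / sinh r + 1 / r)"
    unfolding DR_g_def assms(3) by simp
  ultimately show ?thesis unfolding g by linarith
qed

lemma DR_g_tendsto_1: "(DR_g p q \<longlongrightarrow> 1) at_top"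
proof -
  have half: "filterlim (\<lambda>r::real. r / 2) at_top at_top"
    by (rule filterlim_at_top_mult_tendsto_pos[of "\<lambda>_. 1/2", THEN filterlim_cong[THEN iffD1, rotated -1]])
      (auto intro: filterlim_ident)
  have s: "filterlim (sinh :: real \<Rightarrow> real) at_infinity at_top"
    using sinh_real_at_top filterlim_at_top_imp_at_infinity by blast
  have "((\<lambda>x::real. exp (- x) / sinh x) \<longlongrightarrow> 0) at_top"
    by (rule tendsto_divide_0[OF _ s]) (rule filterlim_compose[OF exp_at_bot filterlim_uminus_at_bot_at_top])
  then have "((\<lambda>r::real. exp (- (r / 2)) / sinh (r / 2)) \<longlongrightarrow> 0) at_top"
    by (rule filterlim_compose[OF _ half])
  note lims = this tendsto_divide_0[OF tendsto_const s, of q]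
    tendsto_divide_0[OF tendsto_const filterlim_at_top_imp_at_infinity[OF filterlim_ident], of "1::real"]
  \<comment> \<open>Here coth(r/2) is written as 1 + exp (- r/2) / sinh (r/2), so that every
    correction tends to 0.\<close>
  have "((\<lambda>r::real. (1 + exp (- (r / 2)) / sinh (r / 2)) - 2 / (p + 2 * q) * (q / sinh r + 1 / r))
      \<longlongrightarrow> (1 + 0) - 2 / (p + 2 * q) * (0 + 0)) at_top"
    by (intro tendsto_diff tendsto_mult tendsto_add tendsto_const lims)
  moreover have "\<forall>\<^sub>F r in at_top. (1 + exp (- (r / 2)) / sinh (r / 2)) - 2 / (p + 2 * q) * (q / sinh r + 1 / r) = DR_g p q r"
    using eventually_gt_at_top[of 0]
    by eventually_elim (simp add: DR_g_def field_simps flip: cosh_minus_sinh)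
  ultimately show ?thesis by (simp add: tendsto_cong)
qed

text \<open>The Riccati-type identity behind the choice \<open>F = (h g / P)\<^sup>P\<^sup>-\<^sup>1\<close>: here \<open>S = h g + 1 / r\<close> is the mean
  curvature of the geodesic sphere of radius \<open>r\<close>.\<close>
lemma mean_curvature_identity:
  fixes r p q h A :: real
  assumes r: "r > 0" and h: "h = (p + 2 * q) / 2"
  defines "S \<equiv> h * (cosh (r / 2) / sinh (r / 2)) - q / sinh r"
  defines "S' \<equiv> - h / (2 * (sinh (r / 2))\<^sup>2) + q * cosh r / (sinh r)\<^sup>2"
  shows "S\<^sup>2 + A * S' = h\<^sup>2 + ((q\<^sup>2 - q * A) / (sinh r)\<^sup>2 + p * (2 * h - A) / (4 * (sinh (r / 2))\<^sup>2))"
proof -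
  define c s where "c = cosh (r / 2)" and "s = sinh (r / 2)"
  have s: "s > 0" and c: "c > 0" using r by (simp_all add: c_def s_def)
  have cs: "c\<^sup>2 = 1 + s\<^sup>2" by (simp add: c_def s_def cosh_square_eq)
  have sr: "sinh r = 2 * s * c" "cosh r = c\<^sup>2 + s\<^sup>2"
    using sinh_double[of "r / 2"] cosh_double[of "r / 2"] by (simp_all add: c_def s_def)
  have S: "S = (2 * h * c\<^sup>2 - q) / (2 * s * c)"
    using s c unfolding S_def sr by (simp add: field_simps power2_eq_square flip: c_def s_def)
  have S': "S' = (- 2 * h * c\<^sup>2 + q * (c\<^sup>2 + s\<^sup>2)) / (2 * s * c)\<^sup>2"
    using s c unfolding S'_def sr by (simp add: field_simps power2_eq_square flip: c_def s_def)
  have R: "h\<^sup>2 + ((q\<^sup>2 - q * A) / (sinh r)\<^sup>2 + p * (2 * h - A) / (4 * (sinh (r / 2))\<^sup>2))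
      = (4 * h\<^sup>2 * s\<^sup>2 * c\<^sup>2 + (q\<^sup>2 - q * A) + p * (2 * h - A) * c\<^sup>2) / (2 * s * c)\<^sup>2"
    using s c unfolding sr by (simp add: field_simps power2_eq_square flip: c_def s_def)
  have p: "p = 2 * h - 2 * q" using h by simp
  \<comment> \<open>Over the common denominator sinh^2 r the identity is polynomial, given c^2 = 1 +
    s^2 and p = 2h - 2q.\<close>
  have "(2 * h * c\<^sup>2 - q)\<^sup>2 + A * (- 2 * h * c\<^sup>2 + q * (c\<^sup>2 + s\<^sup>2))
      = 4 * h\<^sup>2 * s\<^sup>2 * c\<^sup>2 + (q\<^sup>2 - q * A) + p * (2 * h - A) * c\<^sup>2"
    using cs unfolding p by algebra
  then show ?thesis
    unfolding R S S' by (simp add: power_divide flip: add_divide_distrib)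
qed

definition DR_g' :: "real \<Rightarrow> real \<Rightarrow> real \<Rightarrow> real" where
  "DR_g' p q r = - 1 / (2 * (sinh (r / 2))\<^sup>2) + 2 / (p + 2 * q) * (q * cosh r / (sinh r)\<^sup>2 + 1 / r\<^sup>2)"

lemma DR_g_has_derivative: "(DR_g p q has_real_derivative DR_g' p q r) (at r)" if "r > 0"
proof -
  have 1: "((\<lambda>r::real. cosh (r / 2) / sinh (r / 2)) has_real_derivative
      (sinh (r / 2) * (1 / 2) * sinh (r / 2) - cosh (r / 2) * (cosh (r / 2) * (1 / 2))) / (sinh (r / 2) * sinh (r / 2))) (at r)"
    using that by (intro DERIV_divide) (auto intro!: derivative_eq_intros)
  have "sinh (r / 2) * (1 / 2) * sinh (r / 2) - cosh (r / 2) * (cosh (r / 2) * (1 / 2)) = - 1 / 2"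
    using cosh_square_eq[of "r / 2"] by (simp add: power2_eq_square add_divide_distrib)
  then have 1: "((\<lambda>r::real. cosh (r / 2) / sinh (r / 2)) has_real_derivative - 1 / (2 * (sinh (r / 2))\<^sup>2)) (at r)"
    using 1 by (simp add: power2_eq_square)
  have 2: "((\<lambda>r::real. q / sinh r + 1 / r) has_real_derivative - (q * cosh r / (sinh r)\<^sup>2 + 1 / r\<^sup>2)) (at r)"
    using that by (auto intro!: derivative_eq_intros simp: power2_eq_square)
  show ?thesis
    unfolding DR_g_def[abs_def] DR_g'_def
    using DERIV_diff[OF 1 DERIV_cmult[OF 2, of "2 / (p + 2 * q)"]] by (simp only: mult_minus_right diff_minus_eq_add)
qed

lemma continuous_on_DR_g: "continuous_on {0<..} (DR_g p q)"
  by (rule continuous_at_imp_continuous_on) (auto intro: DERIV_isCont DR_g_has_derivative)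

lemma continuous_on_DR_g': "continuous_on {0<..} (DR_g' p q)"
  unfolding DR_g'_def[abs_def] by (intro continuous_intros) auto

lemma DR_g_measurable [measurable]: "DR_g p q \<in> borel_measurable borel"
proof -
  have [measurable]: "sinh \<in> borel_measurable (borel :: real measure)" "cosh \<in> borel_measurable (borel :: real measure)"
    by (intro borel_measurable_continuous_onI continuous_intros)+
  show ?thesis unfolding DR_g_def[abs_def] by measurable
qed

text \<open>The first numerator alone may be negative. Over the common denominator sinh^2 r the sum
  has numerator q^2 - qA + p(2h - A) c^2 with c = cosh(r/2) >= 1; the coefficient of c^2 is
  nonnegative, and at c = 1 the value is (p + q)(p + q - A). At r = 0 both quotients are 0 by the
  convention for division by zero.\<close>

lemma curvature_term_nonneg:
  fixes p q h A r :: real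
  assumes "p \<ge> 0" "q \<ge> 0" "h = (p + 2 * q) / 2" "p + q \<ge> A" "A \<ge> 0"
  shows "(q\<^sup>2 - q * A) / (sinh r)\<^sup>2 + p * (2 * h - A) / (4 * (sinh (r / 2))\<^sup>2) \<ge> 0"
proof (cases "r = 0")
  case False
  define c s where "c = cosh (r / 2)" and "s = sinh (r / 2)"
  have s: "s \<noteq> 0" using False by (simp add: s_def)
  have c: "c \<ge> 1" by (simp add: c_def cosh_real_ge_1)
  have sr: "sinh r = 2 * s * c" using sinh_double[of "r / 2"] by (simp add: c_def s_def)
  have "(q\<^sup>2 - q * A) + p * (2 * h - A) * c\<^sup>2 \<ge> 0"
  proof -
    have "p * (2 * h - A) \<ge> 0" using assms by (intro mult_nonneg_nonneg) auto
    then have "p * (2 * h - A) * 1 \<le> p * (2 * h - A) * c\<^sup>2"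
      using c by (intro mult_left_mono one_le_power)
    moreover have "(q\<^sup>2 - q * A) + p * (2 * h - A) = (p + q) * (p + q - A)"
      using assms(3) by (simp add: algebra_simps power2_eq_square)
    moreover have "(p + q) * (p + q - A) \<ge> 0" using assms by (intro mult_nonneg_nonneg) auto
    ultimately show ?thesis by linarith
  qed
  then have "((q\<^sup>2 - q * A) + p * (2 * h - A) * c\<^sup>2) / (2 * s * c)\<^sup>2 \<ge> 0" by simp
  moreover have "((q\<^sup>2 - q * A) + p * (2 * h - A) * c\<^sup>2) / (2 * s * c)\<^sup>2
     = (q\<^sup>2 - q * A) / (2 * s * c)\<^sup>2 + p * (2 * h - A) / (4 * s\<^sup>2)"
    using s c by (simp add: add_divide_distrib power_mult_distrib)
  ultimately show ?thesis by (simp add: sr s_def)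
qed simp

text \<open>A finite nonnegative integral makes the sum integrable, and each nonnegative summand is
  dominated by it. Only then may the Bochner integral be split, since non-integrable summands would
  count as 0.\<close>

lemma integral_sum_le_of_nonneg:
  fixes f :: "'i \<Rightarrow> 'a \<Rightarrow> real"
  assumes I: "finite I" and f: "\<And>i. i \<in> I \<Longrightarrow> f i \<in> borel_measurable M" and nn: "\<And>i x. i \<in> I \<Longrightarrow> f i x \<ge> 0"
    and le: "(\<integral>\<^sup>+x. ennreal (\<Sum>i\<in>I. f i x) \<partial>M) \<le> ennreal C" and C: "C \<ge> 0"
  shows "(\<Sum>i\<in>I. integral\<^sup>L M (f i)) \<le> C"
proof -
  have "(\<lambda>x. \<Sum>i\<in>I. f i x) \<in> borel_measurable M" using f by (rule borel_measurable_sum)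
  then have int: "integrable M (\<lambda>x. \<Sum>i\<in>I. f i x)"
    using nn le by (intro integrableI_nonneg) (auto intro!: sum_nonneg order.strict_trans1[OF le])
  have inti: "integrable M (f i)" if "i \<in> I" for i
    by (rule Bochner_Integration.integrable_bound[OF int f[OF that]])
      (use nn that I in \<open>auto intro!: member_le_sum simp: sum_nonneg\<close>)
  have "ennreal (\<integral>x. (\<Sum>i\<in>I. f i x) \<partial>M) \<le> ennreal C"
    using le nn int by (subst (asm) nn_integral_eq_integral) (auto intro!: sum_nonneg)
  then have "(\<integral>x. (\<Sum>i\<in>I. f i x) \<partial>M) \<le> C" using C by (simp add: ennreal_le_iff)
  then show ?thesis using inti by (subst (asm) Bochner_Integration.integral_sum) auto
qed

theorem theorem3p5:
  fixes br :: "'v::euclidean_space \<Rightarrow> 'v \<Rightarrow> 'z::euclidean_space"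
    and P :: real and x0 :: "'v \<times> 'z \<times> real"
  assumes "Htype br" and "P \<ge> 2"
    and "real (DIM('v) + DIM('z) + 1) \<ge> 1 + P * (P - 1)"
  defines "p \<equiv> real DIM('v)" and "q \<equiv> real DIM('z)"
    and "h \<equiv> (real DIM('v) + 2 * real DIM('z)) / 2"
  shows "(\<forall>r>0. DR_g p q r \<ge> (p + q - 1) / (h * r))
    \<and> (DR_g p q \<longlongrightarrow> 1) at_top
    \<and> (\<forall>\<phi>. smooth_fun \<phi> \<and> compact_support \<phi> \<longrightarrow>
         (integral\<^sup>L DR_vol (\<lambda>x. DR_grad_norm br \<phi> x powr P)
          - (h / P) powr P * integral\<^sup>L DR_vol
              (\<lambda>x. DR_g p q (DR_dist br x0 x) powr (P - 2) * \<bar>\<phi> x\<bar> powr P)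
          \<ge> h powr (P - 2) * (P - 1)\<^sup>2 / P powr P * integral\<^sup>L DR_vol
              (\<lambda>x. DR_g p q (DR_dist br x0 x) powr (P - 2) / (DR_dist br x0 x)\<^sup>2 * \<bar>\<phi> x\<bar> powr P)
          + h powr (P - 1) * (P - 2) / P powr P * integral\<^sup>L DR_vol
              (\<lambda>x. DR_g p q (DR_dist br x0 x) powr (P - 2)
                   * (DR_g p q (DR_dist br x0 x) + 1 / (h * DR_dist br x0 x))
                   / DR_dist br x0 x * \<bar>\<phi> x\<bar> powr P)
          + h powr (P - 2) / P powr P * integral\<^sup>L DR_vol
              (\<lambda>x. DR_g p q (DR_dist br x0 x) powr (P - 2)
                   * ((q\<^sup>2 - q * P * (P - 1)) / (sinh (DR_dist br x0 x))\<^sup>2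
                      + p * (2 * h - P * (P - 1)) / (4 * (sinh (DR_dist br x0 x / 2))\<^sup>2))
                   * \<bar>\<phi> x\<bar> powr P))
         \<and> (\<forall>x. x \<noteq> x0 \<longrightarrow>
              0 \<le> DR_g p q (DR_dist br x0 x) powr (P - 2) / (DR_dist br x0 x)\<^sup>2 * \<bar>\<phi> x\<bar> powr P
            \<and> 0 \<le> DR_g p q (DR_dist br x0 x) powr (P - 2)
                   * (DR_g p q (DR_dist br x0 x) + 1 / (h * DR_dist br x0 x))
                   / DR_dist br x0 x * \<bar>\<phi> x\<bar> powr P
            \<and> 0 \<le> DR_g p q (DR_dist br x0 x) powr (P - 2)
                   * ((q\<^sup>2 - q * P * (P - 1)) / (sinh (DR_dist br x0 x))\<^sup>2
                      + p * (2 * h - P * (P - 1)) / (4 * (sinh (DR_dist br x0 x / 2))\<^sup>2))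
                   * \<bar>\<phi> x\<bar> powr P))"
proof -
  define A where "A = P * (P - 1)"
  have A: "A \<ge> 0" "p + q \<ge> A" using assms(2,3) by (simp_all add: A_def p_def q_def)
  have pq: "p \<ge> 1" "q \<ge> 1" by (simp_all add: p_def q_def Suc_le_eq)
  have h1: "h = (p + 2 * q) / 2" by (simp add: h_def p_def q_def)
  have h: "h = (p + 2 * q) / 2" "h > 0" using pq unfolding h1 by simp_all
  interpret H_type br by unfold_locales (rule assms(1))
  have ge: "DR_g p q r \<ge> (p + q - 1) / (h * r)" if "r > 0" for r
    using pq h that by (intro DR_g_ge) auto
  have gpos: "DR_g p q r > 0" if "r > 0" for r
  proof -
    have "(p + q - 1) / (h * r) > 0" using pq h that by simp
    then show ?thesis using ge[OF that] by linarith
  qed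
  \<comment> \<open>Index 0 is the spectral term from the left side; 1, 2 and 3 are the Hardy, mixed
    and curvature weights of the right side.\<close>
  define f where "f i r = (if i = (0::nat) then h powr P / P powr P * DR_g p q r powr (P - 2)
      else if i = 1 then h powr (P - 2) * (P - 1)\<^sup>2 / P powr P * (DR_g p q r powr (P - 2) / r\<^sup>2)
      else if i = 2 then h powr (P - 1) * (P - 2) / P powr P
        * (DR_g p q r powr (P - 2) * (DR_g p q r + 1 / (h * r)) / r)
      else h powr (P - 2) / P powr P * (DR_g p q r powr (P - 2)
        * ((q\<^sup>2 - q * P * (P - 1)) / (sinh r)\<^sup>2 + p * (2 * h - P * (P - 1)) / (4 * (sinh (r / 2))\<^sup>2))))" for i r
  have f_eqs: "f 0 = (\<lambda>r. h powr P / P powr P * DR_g p q r powr (P - 2))"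
    "f 1 = (\<lambda>r. h powr (P - 2) * (P - 1)\<^sup>2 / P powr P * (DR_g p q r powr (P - 2) / r\<^sup>2))"
    "f 2 = (\<lambda>r. h powr (P - 1) * (P - 2) / P powr P
        * (DR_g p q r powr (P - 2) * (DR_g p q r + 1 / (h * r)) / r))"
    "f 3 = (\<lambda>r. h powr (P - 2) / P powr P * (DR_g p q r powr (P - 2)
        * ((q\<^sup>2 - q * P * (P - 1)) / (sinh r)\<^sup>2 + p * (2 * h - P * (P - 1)) / (4 * (sinh (r / 2))\<^sup>2))))"
    unfolding f_def by simp_all
  have curv: "(q\<^sup>2 - q * P * (P - 1)) / (sinh r)\<^sup>2 + p * (2 * h - P * (P - 1)) / (4 * (sinh (r / 2))\<^sup>2) \<ge> 0" for r
  proof -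
    have "(q\<^sup>2 - q * A) / (sinh r)\<^sup>2 + p * (2 * h - A) / (4 * (sinh (r / 2))\<^sup>2) \<ge> 0"
      using pq A by (intro curvature_term_nonneg h(1)) auto
    then show ?thesis by (simp only: A_def mult.assoc)
  qed
  \<comment> \<open>The value r = 0 occurs at \<open>x0\<close>; there both summands are 0 by
    division by zero, so the weights are nonnegative everywhere and not just almost
    everywhere.\<close>
  have g_plus: "DR_g p q r + 1 / (h * r) \<ge> 0" if "r \<ge> 0" for r
    using that h gpos[of r] by (cases "r = 0") (auto simp: DR_g_def intro!: add_nonneg_nonneg)
  have t2: "DR_g p q r powr (P - 2) * (DR_g p q r + 1 / (h * r)) / r \<ge> 0" if "r \<ge> 0" for r
    using that g_plus[OF that] by (intro divide_nonneg_nonneg mult_nonneg_nonneg) auto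
  have fnn: "f i r \<ge> 0" if "r \<ge> 0" for i r
    unfolding f_def using assms(2) curv[of r] g_plus[OF that] that
    by (auto intro!: mult_nonneg_nonneg divide_nonneg_nonneg)
  have dist: "DR_dist br x0 x \<ge> 0" for x
    using dist_w_ge_1[of x0 x] by (simp add: DR_dist_eq)
  have mf: "f i \<in> borel_measurable borel" for i
  proof -
    have [measurable]: "sinh \<in> borel_measurable (borel :: real measure)"
      by (intro borel_measurable_continuous_onI continuous_intros)
    show ?thesis unfolding f_def[abs_def] by measurable
  qed
  define V where "V r = (\<Sum>i<4. f i r)" for r
  define F where "F r = (h * DR_g p q r / P) powr (P - 1)" for r
  define F' where "F' r = (P - 1) * (h * DR_g p q r / P) powr (P - 2) * (h * DR_g' p q r / P)" for r
  have dF: "(F has_real_derivative F' r) (at r)" if "r > 0" for r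
  proof -
    have pos: "h * DR_g p q r / P > 0" using gpos[OF that] h assms(2) by simp
    have "((\<lambda>r. h * DR_g p q r / P) has_real_derivative h * DR_g' p q r / P) (at r)"
      by (intro DERIV_cdivide DERIV_cmult DR_g_has_derivative that)
    from DERIV_chain2[where g = "\<lambda>r. h * DR_g p q r / P", OF has_real_derivative_powr[OF pos, of "P - 1"] this]
    show ?thesis unfolding F_def[abs_def] F'_def by simp
  qed
  have cF': "continuous_on {0<..} F'"
    unfolding F'_def[abs_def] using gpos h assms(2)
    by (intro continuous_intros continuous_on_DR_g continuous_on_DR_g') (auto simp: less_imp_neq[symmetric])
  have VF: "V r = F' r + F r * (h * (cosh (r / 2) / sinh (r / 2)) - q / sinh r)
        - (P - 1) * F r powr (P / (P - 1))" if r: "r > 0" for r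
  proof -
    define g R where "g = DR_g p q r" and "R = (q\<^sup>2 - q * A) / (sinh r)\<^sup>2 + p * (2 * h - A) / (4 * (sinh (r / 2))\<^sup>2)"
    define S S' where "S = h * (cosh (r / 2) / sinh (r / 2)) - q / sinh r"
      and "S' = - h / (2 * (sinh (r / 2))\<^sup>2) + q * cosh r / (sinh r)\<^sup>2"
    define c where "c = (h * g / P) powr (P - 2)"
    have P0: "P > 0" and g0: "g > 0" using assms(2) gpos[OF r] by (simp_all add: g_def)
    have id: "S\<^sup>2 + A * S' = h\<^sup>2 + R"
      using mean_curvature_identity[OF r h(1), of A] by (simp add: S_def S'_def R_def)
    have hq: "h * (2 / (p + 2 * q)) = 1" using h by simp
    have m: "h * g = S - 1 / r"
    proof -
      have "h * g = h * (cosh (r / 2) / sinh (r / 2)) - (h * (2 / (p + 2 * q))) * (q / sinh r + 1 / r)"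
        unfolding g_def DR_g_def by (simp only: right_diff_distrib mult.assoc)
      then show ?thesis unfolding hq S_def by simp
    qed
    have m': "h * DR_g' p q r = S' + 1 / r\<^sup>2"
    proof -
      have "h * DR_g' p q r = - h / (2 * (sinh (r / 2))\<^sup>2)
          + (h * (2 / (p + 2 * q))) * (q * cosh r / (sinh r)\<^sup>2 + 1 / r\<^sup>2)"
        unfolding DR_g'_def distrib_left[of h "- 1 / _"] mult.assoc by simp
      then show ?thesis unfolding hq S'_def by simp
    qed
    have gp: "h powr (P - 2) * g powr (P - 2) = c * P powr (P - 2)"
      using h(2) g0 P0 by (simp add: c_def powr_mult powr_divide)
    have pw: "x powr P = x powr (P - 2) * x\<^sup>2" "x powr (P - 1) = x powr (P - 2) * x" if "x > 0" for x :: real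
    proof -
      have "x powr (P - 2 + 2) = x powr (P - 2) * x powr 2" "x powr (P - 2 + 1) = x powr (P - 2) * x powr 1"
        by (rule powr_add)+
      then show "x powr P = x powr (P - 2) * x\<^sup>2" "x powr (P - 1) = x powr (P - 2) * x"
        using that by simp_all
    qed
    have z: "h * g / P > 0" using h g0 P0 by simp
    have "P powr (P - 2) > 0" using P0 by simp
    \<comment> \<open>All four weights share the factor c / P^2, which reduces the claim to an
      identity in S, S' and 1/r.\<close>
    have coef: "h powr (P - 2) * a / P powr P * (g powr (P - 2) * b) = c / P\<^sup>2 * (a * b)" for a b
    proof -
      have "h powr (P - 2) * a / P powr P * (g powr (P - 2) * b)
          = (h powr (P - 2) * g powr (P - 2)) * (a * b) / (P powr (P - 2) * P\<^sup>2)"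
        unfolding pw(1)[OF P0] by simp
      then show ?thesis unfolding gp using \<open>P powr (P - 2) > 0\<close> by simp
    qed
    have "V r = c / P\<^sup>2 * (h\<^sup>2 * 1) + c / P\<^sup>2 * ((P - 1)\<^sup>2 * (1 / r\<^sup>2))
        + c / P\<^sup>2 * (h * (P - 2) * ((g + 1 / (h * r)) / r)) + c / P\<^sup>2 * (1 * R)"
      unfolding coef[symmetric]
      by (simp add: V_def f_def eval_nat_numeral pw[OF h(2)] R_def A_def g_def mult.assoc)
    also have "h * (P - 2) * ((g + 1 / (h * r)) / r) = (P - 2) * S / r"
      using h(2) r m by (simp add: field_simps)
    also have "c / P\<^sup>2 * (h\<^sup>2 * 1) + c / P\<^sup>2 * ((P - 1)\<^sup>2 * (1 / r\<^sup>2)) + c / P\<^sup>2 * ((P - 2) * S / r) + c / P\<^sup>2 * (1 * R)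
        = c / P\<^sup>2 * (S\<^sup>2 + A * S' + (P - 1)\<^sup>2 / r\<^sup>2 + (P - 2) * S / r)"
      unfolding id by (simp add: algebra_simps)
    also have "S\<^sup>2 + A * S' + (P - 1)\<^sup>2 / r\<^sup>2 + (P - 2) * S / r
        = A * (S' + 1 / r\<^sup>2) + P * (S - 1 / r) * S - (P - 1) * (S - 1 / r)\<^sup>2"
    proof -
      define i where "i = 1 / r"
      have "S\<^sup>2 + A * S' + (P - 1)\<^sup>2 * i\<^sup>2 + (P - 2) * S * i
        = A * (S' + i\<^sup>2) + P * (S - i) * S - (P - 1) * (S - i)\<^sup>2"
        unfolding A_def by algebra
      then show ?thesis by (simp add: i_def power_divide)
    qed
    \<comment> \<open>Origin of the constant P(P - 1): the chain rule gives F' the factor (P - 1)/P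
      = A / P^2. The three summands become F', F \<Delta>r and (P - 1) F^(P/(P - 1)), in this
      order.\<close>
    also have "c / P\<^sup>2 * (A * (S' + 1 / r\<^sup>2) + P * (S - 1 / r) * S - (P - 1) * (S - 1 / r)\<^sup>2)
        = (P - 1) * c * (h * DR_g' p q r / P) + c * (h * g / P) * S - (P - 1) * (c * (h * g / P)\<^sup>2)"
      unfolding m m' A_def using P0 by (simp add: power2_eq_square field_simps)
    also have "c * (h * g / P) = F r" using pw(2)[OF z] by (simp add: F_def c_def g_def)
    also have "c * (h * g / P)\<^sup>2 = F r powr (P / (P - 1))"
      using pw(1)[OF z] assms(2) by (simp add: F_def c_def g_def powr_powr)
    also have "(P - 1) * c * (h * DR_g' p q r / P) = F' r" by (simp add: F'_def c_def g_def)
    finally show ?thesis by (simp add: S_def)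
  qed
  have main: "(h / P) powr P * integral\<^sup>L DR_vol
              (\<lambda>x. DR_g p q (DR_dist br x0 x) powr (P - 2) * \<bar>\<phi> x\<bar> powr P)
          + h powr (P - 2) * (P - 1)\<^sup>2 / P powr P * integral\<^sup>L DR_vol
              (\<lambda>x. DR_g p q (DR_dist br x0 x) powr (P - 2) / (DR_dist br x0 x)\<^sup>2 * \<bar>\<phi> x\<bar> powr P)
          + h powr (P - 1) * (P - 2) / P powr P * integral\<^sup>L DR_vol
              (\<lambda>x. DR_g p q (DR_dist br x0 x) powr (P - 2)
                   * (DR_g p q (DR_dist br x0 x) + 1 / (h * DR_dist br x0 x))
                   / DR_dist br x0 x * \<bar>\<phi> x\<bar> powr P)
          + h powr (P - 2) / P powr P * integral\<^sup>L DR_vol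
              (\<lambda>x. DR_g p q (DR_dist br x0 x) powr (P - 2)
                   * ((q\<^sup>2 - q * P * (P - 1)) / (sinh (DR_dist br x0 x))\<^sup>2
                      + p * (2 * h - P * (P - 1)) / (4 * (sinh (DR_dist br x0 x / 2))\<^sup>2))
                   * \<bar>\<phi> x\<bar> powr P)
       \<le> integral\<^sup>L DR_vol (\<lambda>x. DR_grad_norm br \<phi> x powr P)"
    if "smooth_fun \<phi>" "compact_support \<phi>" for \<phi>
  proof -
    define G where "G i x = f i (DR_dist br x0 x) * \<bar>\<phi> x\<bar> powr P" for i x
    have m\<phi>: "\<phi> \<in> borel_measurable borel"
      by (intro borel_measurable_continuous_onI continuous_at_imp_continuous_on ballI
          has_derivative_continuous[OF smooth_fun_C1(1)[OF that(1)]])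
    have "(\<Sum>i<4. integral\<^sup>L DR_vol (G i)) \<le> integral\<^sup>L DR_vol (\<lambda>x. DR_grad_norm br \<phi> x powr P)"
    proof (rule integral_sum_le_of_nonneg)
      show "G i \<in> borel_measurable DR_vol" for i
        using m\<phi> measurable_DR_dist[of x0] mf[of i] unfolding G_def[abs_def] by measurable
      show "G i x \<ge> 0" for i x unfolding G_def using fnn[OF dist] by simp
      have "(\<integral>\<^sup>+x. ennreal (V (DR_dist br x0 x) * \<bar>\<phi> x\<bar> powr P) \<partial>DR_vol)
          \<le> ennreal (integral\<^sup>L DR_vol (\<lambda>x. DR_grad_norm br \<phi> x powr P))"
      proof (rule powr_hardy(2)[where F = F and F' = F' and V = V])
        show "V \<in> borel_measurable borel" unfolding V_def[abs_def] using mf by (intro borel_measurable_sum)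
        show "V r \<ge> 0" if "r > 0" for r unfolding V_def using fnn that by (intro sum_nonneg) simp
        show "V r = F' r + F r * ((real DIM('v) / 2 + real DIM('z)) * (cosh (r / 2) / sinh (r / 2)) - real DIM('z) / sinh r)
            - (P - 1) * F r powr (P / (P - 1))" if "r > 0" for r
          using VF[OF that] by (simp add: h_def q_def add_divide_distrib)
      qed (use assms(2) dF cF' that in \<open>auto simp: F_def\<close>)
      then show "(\<integral>\<^sup>+x. ennreal (\<Sum>i<4. G i x) \<partial>DR_vol)
          \<le> ennreal (integral\<^sup>L DR_vol (\<lambda>x. DR_grad_norm br \<phi> x powr P))"
        by (simp add: V_def G_def sum_distrib_right)
    qed simp_all
    moreover have "(\<Sum>i<4. integral\<^sup>L DR_vol (G i))
        = integral\<^sup>L DR_vol (G 0) + integral\<^sup>L DR_vol (G 1) + integral\<^sup>L DR_vol (G 2) + integral\<^sup>L DR_vol (G 3)"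
      by (simp add: eval_nat_numeral)
    moreover have int: "integral\<^sup>L DR_vol (G i) = c * integral\<^sup>L DR_vol (\<lambda>x. X (DR_dist br x0 x) * \<bar>\<phi> x\<bar> powr P)"
      if "f i = (\<lambda>r. c * X r)" for i c X
      unfolding G_def[abs_def] that mult.assoc by (rule integral_mult_right_zero)
    moreover have "(h / P) powr P = h powr P / P powr P"
      using assms(2) h by (simp add: powr_divide)
    ultimately show ?thesis
      by (simp only: int[OF f_eqs(1)] int[OF f_eqs(2)] int[OF f_eqs(3)] int[OF f_eqs(4)])
  qed
  show ?thesis
  proof (intro conjI allI impI)
    show "DR_g p q r \<ge> (p + q - 1) / (h * r)" if "r > 0" for r using ge[OF that] .
    show "(DR_g p q \<longlongrightarrow> 1) at_top" by (rule DR_g_tendsto_1)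
  next
    fix \<phi> :: "'v \<times> 'z \<times> real \<Rightarrow> real" and x
    show "0 \<le> DR_g p q (DR_dist br x0 x) powr (P - 2) / (DR_dist br x0 x)\<^sup>2 * \<bar>\<phi> x\<bar> powr P" by simp
    show "0 \<le> DR_g p q (DR_dist br x0 x) powr (P - 2)
                   * (DR_g p q (DR_dist br x0 x) + 1 / (h * DR_dist br x0 x))
                   / DR_dist br x0 x * \<bar>\<phi> x\<bar> powr P"
      by (intro mult_nonneg_nonneg t2 dist powr_ge_zero)
    show "0 \<le> DR_g p q (DR_dist br x0 x) powr (P - 2)
                   * ((q\<^sup>2 - q * P * (P - 1)) / (sinh (DR_dist br x0 x))\<^sup>2
                      + p * (2 * h - P * (P - 1)) / (4 * (sinh (DR_dist br x0 x / 2))\<^sup>2))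
                   * \<bar>\<phi> x\<bar> powr P"
      by (intro mult_nonneg_nonneg curv powr_ge_zero)
  qed (use main in \<open>auto simp: algebra_simps\<close>)
qed

end
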